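(* Let $n\ge 20$ and let $U$ be a unicyclic graph of order $n$. Then $$\lambda_{\min}(U^c)\ \ge\ \lambda_{\min}\Big(\mathcal U\big(\lceil (n-2)/2\rceil,\ \lfloor (n-2)/2\rfloor\big)^c\Big),$$ with equality if and only if $U$ is isomorphic to $\mathcal U\big(\lceil (n-2)/2\rceil,\lfloor (n-2)/2\rfloor\big)$.
   Context: All graphs are simple and finite. For a graph $G$, $\lambda_{\min}(G)$ denotes the least eigenvalue of the adjacency matrix $A(G)$, and $G^c$ denotes the complement of $G$. A unicyclic graph is a connected graph containing exactly one cycle. $K_{1,m}$ is the star with $m$ edges; its vertex of degree $m$ is the center and the others are pendant vertices. $S_m^3$ denotes the graph of order $m$ obtained from the star $K_{1,m-1}$ by adding one edge between two of its pendant vertices. For integers $p\ge 1$ and $q\ge 3$, $\mathcal U(p,q)$ is the graph of order $p+q+2$ obtained from disjoint copies of $K_{1,p}$ and $S_{q+1}^3$ by adding one edge joining a pendant (degree-one) vertex of $K_{1,p}$ to a pendant (degree-one) vertex of $S_{q+1}^3$. *)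

theory Defs
  imports Complex_Main "Jordan_Normal_Form.Char_Poly"
begin

definition simple_graph :: "nat \<Rightarrow> (nat \<Rightarrow> nat \<Rightarrow> bool) \<Rightarrow> bool" where
  "simple_graph n E \<longleftrightarrow> (\<forall>i j. E i j \<longrightarrow> i < n \<and> j < n \<and> i \<noteq> j \<and> E j i)"

definition adj_mat :: "nat \<Rightarrow> (nat \<Rightarrow> nat \<Rightarrow> bool) \<Rightarrow> real mat" where
  "adj_mat n E = mat n n (\<lambda>(i, j). if E i j then 1 else 0)"

definition lambda_min :: "nat \<Rightarrow> (nat \<Rightarrow> nat \<Rightarrow> bool) \<Rightarrow> real" where
  "lambda_min n E = Min {x. eigenvalue (adj_mat n E) x}"

definition complement :: "nat \<Rightarrow> (nat \<Rightarrow> nat \<Rightarrow> bool) \<Rightarrow> nat \<Rightarrow> nat \<Rightarrow> bool" where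
  "complement n E i j \<longleftrightarrow> i < n \<and> j < n \<and> i \<noteq> j \<and> \<not> E i j"

definition connected_graph :: "nat \<Rightarrow> (nat \<Rightarrow> nat \<Rightarrow> bool) \<Rightarrow> bool" where
  "connected_graph n E \<longleftrightarrow> (\<forall>i<n. \<forall>j<n. E\<^sup>*\<^sup>* i j)"

definition cycle_edge_set :: "nat \<Rightarrow> (nat \<Rightarrow> nat \<Rightarrow> bool) \<Rightarrow> nat set set \<Rightarrow> bool" where
  "cycle_edge_set n E C \<longleftrightarrow> (\<exists>vs. 3 \<le> length vs \<and> distinct vs \<and> set vs \<subseteq> {0..<n} \<and>
      (\<forall>i<length vs. E (vs ! i) (vs ! ((i + 1) mod length vs))) \<and>
      C = {{vs ! i, vs ! ((i + 1) mod length vs)} | i. i < length vs})"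

definition unicyclic :: "nat \<Rightarrow> (nat \<Rightarrow> nat \<Rightarrow> bool) \<Rightarrow> bool" where
  "unicyclic n E \<longleftrightarrow> simple_graph n E \<and> connected_graph n E \<and> card {C. cycle_edge_set n E C} = 1"

definition graph_iso :: "nat \<Rightarrow> (nat \<Rightarrow> nat \<Rightarrow> bool) \<Rightarrow> nat \<Rightarrow> (nat \<Rightarrow> nat \<Rightarrow> bool) \<Rightarrow> bool" where
  "graph_iso n E m F \<longleftrightarrow> (\<exists>f. bij_betw f {0..<n} {0..<m} \<and>
      (\<forall>i<n. \<forall>j<n. E i j \<longleftrightarrow> F (f i) (f j)))"

text \<open>The graph U(p,q) of order p+q+2: K_{1,p} with centre 0 and pendants 1..p;
S^3_{q+1} with centre p+1, pendants p+2..p+q+1 and the extra edge {p+2,p+3};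
plus the edge joining pendant 1 of K_{1,p} to the degree-one pendant p+q+1
of S^3_{q+1} (q >= 3 so p+q+1 > p+3).\<close>
definition U_edge :: "nat \<Rightarrow> nat \<Rightarrow> nat \<Rightarrow> nat \<Rightarrow> bool" where
  "U_edge p q i j \<longleftrightarrow> i \<noteq> j \<and>
     ({i, j} \<in> {{0, k} | k. 1 \<le> k \<and> k \<le> p}
      \<or> {i, j} \<in> {{p + 1, k} | k. p + 2 \<le> k \<and> k \<le> p + q + 1}
      \<or> {i, j} = {p + 2, p + 3}
      \<or> {i, j} = {1, p + q + 1})"

end

theory Submission
  imports Defs "HOL-Analysis.Function_Topology"
begin

text \<open>
  Since \<open>A(G^c) = J - I - A(G)\<close>, minimising \<open>\<lambda>_min(G^c)\<close> means maximising the top eigenvalue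
  \<open>\<mu>(G) = -1 - \<lambda>_min(G^c)\<close> of \<open>A(G) - J\<close>. Take an eigenvector \<open>x\<close> for \<open>\<mu>(U)\<close> and split the vertices
  into \<open>P\<close> (\<open>x \<ge> 0\<close>) and \<open>N\<close> (\<open>x \<le> 0\<close>). Deleting a suitable edge of the cycle leaves a tree; rooting
  it at the entry of largest modulus in \<open>P\<close>, respectively \<open>N\<close>, shows that the edges inside each part
  contribute at most what a star does, while some edge crosses and contributes at most the product
  of the two entries of smallest modulus. After replacing \<open>x\<close> by \<open>-x\<close> if necessary, the deleted edge
  crosses or lies in \<open>N\<close> away from its root, so \<open>\<mu>(U) \<le> \<mu>(U(p,q))\<close> with \<open>|P| = p + 1\<close> and
  \<open>|N| = q + 1\<close>, apart from very small \<open>P\<close> or \<open>N\<close>, where \<open>\<mu>(U) \<le> 3\<close>.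

  The number \<open>\<mu>(U(p,q))\<close> is a root of a polynomial that is linear in \<open>p\<close>, \<open>q\<close> and \<open>pq\<close>, with negative
  leading coefficient in \<open>\<mu>\<close>. If \<open>(p,q)\<close> is not balanced, the polynomial of the balanced pair is positive
  at every root \<open>\<mu> > 3\<close> of the one for \<open>(p,q)\<close>, hence has a larger root; at \<open>\<mu> = 3\<close> it is positive
  too, and this is where \<open>n \<ge> 20\<close> enters. In the case of equality the eigenvector of the balanced
  graph has strictly ordered entries, so all the estimates above are tight only for that graph.
\<close>

section \<open>The least eigenvalue of a complement as a maximum\<close>

text \<open>Ordered pairs are summed, so every edge counts twice; hence the factors 2 below.\<close>

definition adj_sum :: "nat \<Rightarrow> (nat \<Rightarrow> nat \<Rightarrow> bool) \<Rightarrow> (nat \<Rightarrow> nat \<Rightarrow> real) \<Rightarrow> real" where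
  "adj_sum n E w = (\<Sum>i<n. \<Sum>j<n. if E i j then w i j else 0)"

definition nbr_sum :: "nat \<Rightarrow> (nat \<Rightarrow> nat \<Rightarrow> bool) \<Rightarrow> (nat \<Rightarrow> real) \<Rightarrow> nat \<Rightarrow> real" where
  "nbr_sum n E x i = (\<Sum>j<n. if E i j then x j else 0)"

definition vsum :: "nat \<Rightarrow> (nat \<Rightarrow> real) \<Rightarrow> real" where
  "vsum n x = (\<Sum>i<n. x i)"

definition sq_norm :: "nat \<Rightarrow> (nat \<Rightarrow> real) \<Rightarrow> real" where
  "sq_norm n x = (\<Sum>i<n. (x i)\<^sup>2)"

text \<open>The quadratic form of \<open>A - J\<close>, with \<open>J\<close> the all-ones
  matrix.\<close>

definition quad :: "nat \<Rightarrow> (nat \<Rightarrow> nat \<Rightarrow> bool) \<Rightarrow> (nat \<Rightarrow> real) \<Rightarrow> real" where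
  "quad n E x = adj_sum n E (\<lambda>i j. x i * x j) - (vsum n x)\<^sup>2"

text \<open>The equation \<open>(A - J) x = \<mu> x\<close>. The zero vector satisfies it, so
  non-triviality is stated separately where it matters.\<close>

definition eigvec :: "nat \<Rightarrow> (nat \<Rightarrow> nat \<Rightarrow> bool) \<Rightarrow> real \<Rightarrow> (nat \<Rightarrow> real) \<Rightarrow> bool" where
  "eigvec n E \<mu> x \<longleftrightarrow> (\<forall>i<n. nbr_sum n E x i = \<mu> * x i + vsum n x)"

definition colambda :: "nat \<Rightarrow> (nat \<Rightarrow> nat \<Rightarrow> bool) \<Rightarrow> real" where
  "colambda n E = -1 - lambda_min n (complement n E)"

lemma sq_norm_pos: "i < n \<Longrightarrow> x i \<noteq> 0 \<Longrightarrow> sq_norm n x > 0"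
  unfolding sq_norm_def by (rule sum_pos2[of _ i]) auto

text \<open>Vectors are functions on all naturals; fixing the coordinates from \<open>n\<close> on
  to 0 makes the box a product of compact sets, and Tychonoff applies.\<close>

lemma compact_bounded_functions:
  "compact {x :: nat \<Rightarrow> real. \<forall>i. x i \<in> (if i < n then {-1..1} else {0})}"
proof -
  have "compactin (product_topology (\<lambda>i. euclidean) UNIV)
          (PiE UNIV (\<lambda>i. if i < n then {-1..1} else {0::real}))"
    by (subst compactin_PiE) (auto simp: compactin_euclidean_iff)
  moreover have "PiE UNIV (\<lambda>i. if i < n then {-1..1} else {0::real})
      = {x. \<forall>i. x i \<in> (if i < n then {-1..1} else {0})}"
    by (auto simp: PiE_def Pi_def)
  ultimately show ?thesis
    by (simp add: euclidean_product_topology compactin_euclidean_iff)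
qed

lemma continuous_on_coord: "continuous_on S (\<lambda>x. x (i::nat) :: real)"
  by (rule continuous_on_subset[OF continuous_on_product_coordinates]) auto

text \<open>A continuous form attains its maximum on the compact unit sphere; homogeneity carries
  the bound to all vectors.\<close>

lemma quad_attains_max:
  assumes "n > 0"
  obtains x where "sq_norm n x = 1" "\<And>y. quad n E y \<le> quad n E x * sq_norm n y"
proof -
  define K where "K = {x :: nat \<Rightarrow> real. \<forall>i. x i \<in> (if i < n then {-1..1} else {0})}"
  define S where "S = K \<inter> {x. sq_norm n x = 1}"
  have cn: "continuous_on UNIV (sq_norm n)"
    unfolding sq_norm_def by (intro continuous_intros continuous_on_coord)
  have "closed {x. sq_norm n x = 1}"
    by (rule closed_Collect_eq[OF cn continuous_on_const])
  then have S: "compact S"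
    unfolding S_def K_def using compact_bounded_functions by (rule compact_Int_closed[rotated])
  have cq: "continuous_on S (quad n E)"
  proof -
    have "continuous_on S (\<lambda>x. if E i j then x i * x j else 0)" for i j
      by (cases "E i j") (auto intro!: continuous_intros continuous_on_coord)
    then show ?thesis
      unfolding quad_def adj_sum_def vsum_def
      by (intro continuous_intros continuous_on_coord)
  qed
  have "(\<lambda>i. if i = 0 then 1 else 0) \<in> S"
    using assms unfolding S_def K_def sq_norm_def
    by (auto simp: sum.delta if_distrib[where f="\<lambda>x. x ^ _"] cong: if_cong)
  then obtain x where x: "x \<in> S" "\<And>y. y \<in> S \<Longrightarrow> quad n E y \<le> quad n E x"
    using continuous_attains_sup[OF S _ cq] by blast
  have "quad n E y \<le> quad n E x * sq_norm n y" for y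
  proof (cases "sq_norm n y = 0")
    case True
    then have z: "i < n \<Longrightarrow> y i = 0" for i using sq_norm_pos[of i n y] by force
    have "quad n E y = 0" unfolding quad_def adj_sum_def vsum_def
      by (simp add: z sum.neutral)
    then show ?thesis using True by simp
  next
    case False
    then have pos: "sq_norm n y > 0"
      unfolding sq_norm_def by (metis less_eq_real_def sum_nonneg zero_le_power2)
    define c where "c = 1 / sqrt (sq_norm n y)"
    have c: "c\<^sup>2 * sq_norm n y = 1" "c\<^sup>2 > 0" unfolding c_def using pos
      by (auto simp: power_divide)
    \<comment> \<open>\<open>y\<close> is arbitrary beyond \<open>n\<close>, while \<open>K\<close>
      prescribes 0 there; hence the truncation.\<close>
    define z where "z = (\<lambda>i. if i < n then c * y i else 0)"
    have nz: "sq_norm n z = 1"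
      using c unfolding sq_norm_def z_def by (simp add: power_mult_distrib sum_distrib_left)
    have "\<bar>z i\<bar> \<le> 1" if "i < n" for i
    proof -
      have "(z i)\<^sup>2 \<le> (\<Sum>i<n. (z i)\<^sup>2)"
        using that by (intro member_le_sum) auto
      then have "(z i)\<^sup>2 \<le> 1" using nz by (simp add: sq_norm_def)
      then show ?thesis by (simp add: abs_square_le_1)
    qed
    then have "z \<in> S" using nz unfolding S_def K_def by (auto simp: z_def abs_le_iff)
    then have "quad n E z \<le> quad n E x" by (rule x)
    moreover have "quad n E z = c\<^sup>2 * quad n E y"
    proof -
      have "adj_sum n E (\<lambda>i j. z i * z j) = c\<^sup>2 * adj_sum n E (\<lambda>i j. y i * y j)"
        unfolding adj_sum_def z_def sum_distrib_left
        by (intro sum.cong) (auto simp: power2_eq_square)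
      moreover have "vsum n z = c * vsum n y"
        unfolding vsum_def z_def by (simp add: sum_distrib_left)
      ultimately show ?thesis unfolding quad_def by (simp add: algebra_simps power_mult_distrib)
    qed
    ultimately have "c\<^sup>2 * quad n E y * sq_norm n y \<le> quad n E x * sq_norm n y"
      using pos by (intro mult_right_mono) auto
    moreover have "c\<^sup>2 * quad n E y * sq_norm n y = quad n E y * (c\<^sup>2 * sq_norm n y)"
      by (simp only: mult_ac)
    ultimately show ?thesis using c(1) by simp
  qed
  moreover have "sq_norm n x = 1" using x(1) by (simp add: S_def)
  ultimately show ?thesis using that by blast
qed

text \<open>Varying one coordinate isolates one component of the gradient; the quadratic term comes
  from the diagonal of \<open>- J\<close>.\<close>

lemma quad_perturb:
  assumes "simple_graph n E" "k < n"
  shows "quad n E (\<lambda>i. x i + (if i = k then t else 0))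
    = quad n E x + 2 * t * (nbr_sum n E x k - vsum n x) - t\<^sup>2"
proof -
  have sym: "E i j = E j i" and irr: "\<not> E i i" for i j
    using assms(1) by (auto simp: simple_graph_def)
  have "adj_sum n E (\<lambda>i j. (x i + (if i = k then t else 0)) * (x j + (if j = k then t else 0)))
    = (\<Sum>i<n. \<Sum>j<n. (if E i j then x i * x j else 0) + (if i = k then (if E k j then t * x j else 0) else 0)
        + (if j = k then (if E k i then t * x i else 0) else 0))"
    unfolding adj_sum_def using sym irr
    by (intro sum.cong refl) (auto simp: algebra_simps)
  also have "\<dots> = adj_sum n E (\<lambda>i j. x i * x j) + 2 * t * nbr_sum n E x k"
  proof -
    have 1: "(\<Sum>i<n. \<Sum>j<n. if i = k then (if E k j then t * x j else 0) else 0) = t * nbr_sum n E x k"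
    proof -
      have "(\<Sum>j<n. if i = k then (if E k j then t * x j else 0) else 0)
        = (if i = k then (\<Sum>j<n. if E k j then t * x j else 0) else 0)" for i by auto
      then show ?thesis using assms(2)
        by (simp add: nbr_sum_def sum_distrib_left if_distrib[where f="\<lambda>x. t * x"] cong: if_cong)
    qed
    have 2: "(\<Sum>i<n. \<Sum>j<n. if j = k then (if E k i then t * x i else 0) else 0) = t * nbr_sum n E x k"
      unfolding nbr_sum_def sum_distrib_left using assms(2)
      by (intro sum.cong refl) (auto simp: sum.delta)
    show ?thesis unfolding sum.distrib 1 2 adj_sum_def by simp
  qed
  moreover have "vsum n (\<lambda>i. x i + (if i = k then t else 0)) = vsum n x + t"
    unfolding vsum_def using assms(2) by (simp add: sum.distrib)
  ultimately show ?thesis unfolding quad_def by (simp add: algebra_simps power2_eq_square)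
qed

lemma sq_norm_perturb:
  assumes "k < n"
  shows "sq_norm n (\<lambda>i. x i + (if i = k then t else 0)) = sq_norm n x + 2 * t * x k + t\<^sup>2"
proof -
  have "sq_norm n (\<lambda>i. x i + (if i = k then t else 0))
    = (\<Sum>i<n. (x i)\<^sup>2 + (if i = k then 2 * t * x k + t\<^sup>2 else 0))"
    unfolding sq_norm_def by (intro sum.cong) (auto simp: power2_eq_square algebra_simps)
  then show ?thesis using assms by (simp add: sum.distrib sq_norm_def)
qed

lemma linear_coeff_zero:
  fixes a b :: real
  assumes "\<And>t. t * a \<le> b * t\<^sup>2"
  shows "a = 0"
proof -
  \<comment> \<open>Any positive \<open>c > b\<close> would do: at \<open>t = a / c\<close> the
    linear term dominates unless \<open>a = 0\<close>.\<close>
  define c where "c = \<bar>b\<bar> + 1"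
  have c: "c > 0" "b \<le> c - 1" by (auto simp: c_def)
  have "(a / c) * a \<le> b * (a / c)\<^sup>2" by (rule assms)
  also have "\<dots> \<le> (c - 1) * (a / c)\<^sup>2" using c by (intro mult_right_mono) auto
  finally have "a\<^sup>2 * c \<le> (c - 1) * a\<^sup>2" using c
    by (simp add: field_simps power2_eq_square)
  then have "a\<^sup>2 \<le> 0" by (simp add: algebra_simps)
  then show ?thesis by simp
qed

text \<open>First-order condition: where the bound is attained all partial derivatives vanish, and
  these are the rows of the eigenvalue equation.\<close>

lemma eigvec_if_max:
  assumes G: "simple_graph n E" and max: "\<And>y. quad n E y \<le> \<mu> * sq_norm n y"
    and eq: "quad n E x = \<mu> * sq_norm n x"
  shows "eigvec n E \<mu> x"
  unfolding eigvec_def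
proof (intro allI impI)
  fix k assume k: "k < n"
  have "t * (2 * (nbr_sum n E x k - vsum n x - \<mu> * x k)) \<le> (\<mu> + 1) * t\<^sup>2" for t
    using max[of "\<lambda>i. x i + (if i = k then t else 0)"]
    unfolding quad_perturb[OF G k] sq_norm_perturb[OF k] eq by (simp add: algebra_simps)
  then have "2 * (nbr_sum n E x k - vsum n x - \<mu> * x k) = 0" by (rule linear_coeff_zero)
  then show "nbr_sum n E x k = \<mu> * x k + vsum n x" by simp
qed

lemma quad_eigvec:
  assumes "eigvec n E \<mu> x"
  shows "quad n E x = \<mu> * sq_norm n x"
proof -
  have "adj_sum n E (\<lambda>i j. x i * x j) = (\<Sum>i<n. x i * nbr_sum n E x i)"
    unfolding adj_sum_def nbr_sum_def sum_distrib_left by (intro sum.cong) auto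
  also have "\<dots> = (\<Sum>i<n. \<mu> * (x i)\<^sup>2 + x i * vsum n x)"
    using assms by (intro sum.cong) (auto simp: eigvec_def algebra_simps power2_eq_square)
  also have "\<dots> = \<mu> * sq_norm n x + (vsum n x)\<^sup>2"
    by (simp add: sum.distrib sq_norm_def vsum_def sum_distrib_left[symmetric]
        sum_distrib_right[symmetric] power2_eq_square)
  finally show ?thesis by (simp add: quad_def)
qed

text \<open>By \<open>A(G^c) = J - I - A(G)\<close>, an eigenvalue \<open>l\<close> of the
  complement corresponds to \<open>-1 - l\<close> for \<open>A - J\<close>, with the same
  eigenvectors.\<close>

lemma eigenvalue_complement_iff:
  assumes G: "simple_graph n E"
  shows "eigenvalue (adj_mat n (complement n E)) l \<longleftrightarrow> (\<exists>x. eigvec n E (-1 - l) x \<and> (\<exists>i<n. x i \<noteq> 0))"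
proof -
  let ?A = "adj_mat n (complement n E)"
  have A: "?A \<in> carrier_mat n n" by (simp add: adj_mat_def)
  have Av: "(?A *\<^sub>v vec n x) $ i = vsum n x - x i - nbr_sum n E x i" if "i < n" for x i
  proof -
    have "(?A *\<^sub>v vec n x) $ i = (\<Sum>j<n. (if complement n E i j then 1 else 0) * x j)"
      using that by (simp add: adj_mat_def scalar_prod_def lessThan_atLeast0)
    also have "\<dots> = (\<Sum>j<n. x j - (if i = j then x j else 0) - (if E i j then x j else 0))"
      using that G by (intro sum.cong) (auto simp: complement_def simple_graph_def)
    also have "\<dots> = vsum n x - x i - nbr_sum n E x i"
      using that by (simp add: sum_subtractf vsum_def nbr_sum_def)
    finally show ?thesis .
  qed
  have *: "?A *\<^sub>v vec n x = l \<cdot>\<^sub>v vec n x \<longleftrightarrow> eigvec n E (-1 - l) x" for x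
  proof -
    have "?A *\<^sub>v vec n x = l \<cdot>\<^sub>v vec n x \<longleftrightarrow> (\<forall>i<n. (?A *\<^sub>v vec n x) $ i = l * x i)"
      using A by (auto simp: vec_eq_iff)
    also have "\<dots> \<longleftrightarrow> eigvec n E (-1 - l) x"
      unfolding eigvec_def by (auto simp: Av algebra_simps)
    finally show ?thesis .
  qed
  show ?thesis
  proof
    assume "eigenvalue ?A l"
    then obtain v where v: "v \<in> carrier_vec n" "v \<noteq> 0\<^sub>v n" "?A *\<^sub>v v = l \<cdot>\<^sub>v v"
      using A by (auto simp: eigenvalue_def eigenvector_def)
    have "v = vec n (\<lambda>i. v $ i)" using v(1) by auto
    moreover have "\<exists>i<n. v $ i \<noteq> 0" using v(1,2) by (auto simp: vec_eq_iff)
    ultimately show "\<exists>x. eigvec n E (-1 - l) x \<and> (\<exists>i<n. x i \<noteq> 0)"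
      using * v(3) by metis
  next
    assume "\<exists>x. eigvec n E (-1 - l) x \<and> (\<exists>i<n. x i \<noteq> 0)"
    then obtain x i where x: "eigvec n E (-1 - l) x" "i < n" "x i \<noteq> 0" by blast
    have "vec n x \<noteq> 0\<^sub>v n" using x(2,3) by (metis index_vec index_zero_vec(1))
    then show "eigenvalue ?A l" using * x(1) A
      by (auto simp: eigenvalue_def eigenvector_def intro!: exI[of _ "vec n x"])
  qed
qed

text \<open>The maximiser of the Rayleigh quotient is an eigenvector, and its value bounds all
  eigenvalues of \<open>A - J\<close>; so this maximum is \<open>colambda\<close>.\<close>

lemma colambda_props:
  assumes n: "n > 0" and G: "simple_graph n E"
  shows quad_le_colambda: "quad n E y \<le> colambda n E * sq_norm n y"
    and colambda_eigvec: "\<exists>x. eigvec n E (colambda n E) x \<and> (\<exists>i<n. x i \<noteq> 0)"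
proof -
  let ?A = "adj_mat n (complement n E)"
  have A: "?A \<in> carrier_mat n n" by (simp add: adj_mat_def)
  obtain x where x: "sq_norm n x = 1" "\<And>y. quad n E y \<le> quad n E x * sq_norm n y"
    using quad_attains_max[OF n] by blast
  define \<mu> where "\<mu> = quad n E x"
  have ev: "eigvec n E \<mu> x"
    by (rule eigvec_if_max[OF G]) (use x in \<open>auto simp: \<mu>_def\<close>)
  have nz: "\<exists>i<n. x i \<noteq> 0"
  proof (rule ccontr)
    assume "\<not> ?thesis" then have "sq_norm n x = 0" by (simp add: sq_norm_def)
    then show False using x(1) by simp
  qed
  \<comment> \<open>\<open>lambda_min\<close> is a \<open>Min\<close>, which has the intended
    meaning on finite sets.\<close>
  have "finite {l. eigenvalue ?A l}"
  proof -
    have "char_poly ?A \<noteq> 0" using degree_monic_char_poly[OF A] by auto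
    then show ?thesis unfolding eigenvalue_root_char_poly[OF A] by (rule poly_roots_finite)
  qed
  moreover have "eigenvalue ?A (-1 - \<mu>)"
    using eigenvalue_complement_iff[OF G] ev nz by auto
  moreover have "-1 - \<mu> \<le> l" if l: "eigenvalue ?A l" for l
  proof -
    obtain y i where y: "eigvec n E (-1 - l) y" "i < n" "y i \<noteq> 0"
      using l[unfolded eigenvalue_complement_iff[OF G]] by blast
    have "(-1 - l) * sq_norm n y \<le> \<mu> * sq_norm n y"
      using x(2)[of y] quad_eigvec[OF y(1)] by (simp add: \<mu>_def)
    then show ?thesis using sq_norm_pos[of i n y] y(2,3) by simp
  qed
  ultimately have "lambda_min n (complement n E) = -1 - \<mu>"
    unfolding lambda_min_def by (intro Min_eqI) auto
  then have c: "colambda n E = \<mu>" by (simp add: colambda_def)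
  show "quad n E y \<le> colambda n E * sq_norm n y" unfolding c \<mu>_def by (rule x(2))
  show "\<exists>x. eigvec n E (colambda n E) x \<and> (\<exists>i<n. x i \<noteq> 0)" unfolding c using ev nz by blast
qed

lemma colambda_ge:
  assumes "simple_graph n E" "eigvec n E m x" "i < n" "x i \<noteq> 0"
  shows "m \<le> colambda n E"
proof -
  have "m * sq_norm n x \<le> colambda n E * sq_norm n x"
    using quad_le_colambda[of n E x] assms quad_eigvec by fastforce
  then show ?thesis using sq_norm_pos[of i n x] assms(3,4) by simp
qed

section \<open>Trees inside a unicyclic graph\<close>

definition del_edge :: "(nat \<Rightarrow> nat \<Rightarrow> bool) \<Rightarrow> nat \<Rightarrow> nat \<Rightarrow> nat \<Rightarrow> nat \<Rightarrow> bool" where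
  "del_edge E k l i j \<longleftrightarrow> E i j \<and> {i, j} \<noteq> {k, l}"

lemma simple_graph_del_edge: "simple_graph n E \<Longrightarrow> simple_graph n (del_edge E k l)"
  unfolding simple_graph_def del_edge_def by (metis insert_commute)

lemma rtranclp_sym: "simple_graph n E \<Longrightarrow> E\<^sup>*\<^sup>* a b \<Longrightarrow> E\<^sup>*\<^sup>* b a"
  by (metis simple_graph_def symp_rtranclp sympI sympD)

text \<open>When the walk returns to a vertex of the path built so far, the path is cut back to that
  vertex.\<close>

lemma rtranclp_distinct_path:
  assumes "E\<^sup>*\<^sup>* a b"
  shows "\<exists>vs. vs \<noteq> [] \<and> hd vs = a \<and> last vs = b \<and> distinct vs \<and> successively E vs"
  using assms
proof (induction rule: rtranclp_induct)
  case base
  show ?case by (intro exI[of _ "[a]"]) simp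
next
  case (step y z)
  then obtain vs where vs: "vs \<noteq> []" "hd vs = a" "last vs = y" "distinct vs" "successively E vs"
    by blast
  show ?case
  proof (cases "z \<in> set vs")
    case True
    then obtain us ws where uw: "vs = us @ z # ws" by (meson split_list)
    have "hd (us @ [z]) = a" using vs(2) uw by (cases us) auto
    then show ?thesis using vs uw
      by (intro exI[of _ "us @ [z]"]) (auto simp: successively_append_iff)
  next
    case False
    then show ?thesis using vs step(2)
      by (intro exI[of _ "vs @ [z]"]) (auto simp: successively_append_iff)
  qed
qed

text \<open>A path from \<open>a\<close> to \<open>b\<close> avoiding the edge would close up with
  it to a cycle.\<close>

lemma acyclic_edge_is_bridge:
  assumes G: "simple_graph n E" and ac: "\<And>C. \<not> cycle_edge_set n E C" and ab: "E a b"
  shows "\<not> (del_edge E a b)\<^sup>*\<^sup>* a b"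
proof
  assume "(del_edge E a b)\<^sup>*\<^sup>* a b"
  then obtain vs where vs: "vs \<noteq> []" "hd vs = a" "last vs = b" "distinct vs"
      "successively (del_edge E a b) vs"
    using rtranclp_distinct_path by metis
  have ne: "a \<noteq> b" and ba: "E b a" using G ab by (auto simp: simple_graph_def)
  \<comment> \<open>With two vertices the path would be the deleted edge itself.\<close>
  have len: "3 \<le> length vs"
  proof (rule ccontr)
    assume "\<not> ?thesis"
    then consider u where "vs = [u]" | u v where "vs = [u, v]" using vs(1)
      by (cases vs; cases "tl vs"; cases "tl (tl vs)") auto
    then show False using vs ne by cases (auto simp: del_edge_def)
  qed
  have step: "E (vs ! i) (vs ! Suc i)" if "Suc i < length vs" for i
    using vs(5) that by (auto simp: successively_conv_nth del_edge_def)
  have edge: "E (vs ! i) (vs ! ((i + 1) mod length vs))" if "i < length vs" for i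
  proof (cases "Suc i = length vs")
    case True
    then have "vs ! i = b" using vs(1,3) by (metis diff_Suc_1 last_conv_nth)
    moreover have "vs ! 0 = a" using vs(1,2) by (simp add: hd_conv_nth)
    ultimately show ?thesis using True ba by simp
  next
    case False
    then show ?thesis using step[of i] that by simp
  qed
  have "set vs \<subseteq> {0..<n}"
  proof
    fix v assume "v \<in> set vs"
    then obtain i where "i < length vs" "v = vs ! i" by (metis in_set_conv_nth)
    then show "v \<in> {0..<n}" using edge[of i] G by (auto simp: simple_graph_def)
  qed
  then have "cycle_edge_set n E {{vs ! i, vs ! ((i + 1) mod length vs)} | i. i < length vs}"
    unfolding cycle_edge_set_def using len vs(4) edge by blast
  then show False using ac by blast
qed

text \<open>The rest of the cycle joins the ends of the deleted edge, so every walk can be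
  rerouted.\<close>

lemma del_cycle_edge_connected:
  assumes G: "simple_graph n E" and conn: "connected_graph n E"
    and vs: "3 \<le> length vs" "distinct vs"
    and cyc: "\<And>i. i < length vs \<Longrightarrow> E (vs ! i) (vs ! ((i + 1) mod length vs))"
    and i0: "i0 < length vs" and k: "k = vs ! i0" and l: "l = vs ! ((i0 + 1) mod length vs)"
  shows "connected_graph n (del_edge E k l)"
proof -
  let ?L = "length vs" and ?D = "del_edge E k l"
  have L: "?L > 0" using vs(1) by linarith
  \<comment> \<open>Follows the cycle from \<open>l\<close>, at position \<open>i0 + 1\<close>;
    after \<open>length vs - 1\<close> steps it arrives at \<open>k\<close>.\<close>
  have walk: "?D\<^sup>*\<^sup>* l (vs ! ((i0 + 1 + t) mod ?L))" if "t \<le> ?L - 1" for t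
    using that
  proof (induction t)
    case 0 then show ?case by (simp add: l)
  next
    case (Suc t)
    define j where "j = (i0 + 1 + t) mod ?L"
    have j: "j < ?L" using L by (simp add: j_def)
    have j': "(j + 1) mod ?L = (i0 + 1 + Suc t) mod ?L" by (simp add: j_def mod_simps)
    have jne: "j \<noteq> i0"
    proof
      assume "j = i0"
      then have "(i0 + 1 + t) mod ?L = i0 mod ?L" using i0 by (simp add: j_def)
      then have "?L dvd (i0 + 1 + t) - i0" by (metis le_add1 mod_eq_dvd_iff_nat add.assoc)
      then have "?L dvd Suc t" by simp
      then show False using Suc.prems L by (auto dest: dvd_imp_le)
    qed
    \<comment> \<open>As \<open>j\<close> differs from \<open>i0\<close>, the deleted edge could
      only be met in reverse, which forces a cycle of length 2.\<close>
    have "{vs ! j, vs ! ((j + 1) mod ?L)} \<noteq> {k, l}"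
    proof
      assume "{vs ! j, vs ! ((j + 1) mod ?L)} = {k, l}"
      then have "vs ! j = vs ! ((i0 + 1) mod ?L)" "vs ! ((j + 1) mod ?L) = vs ! i0"
        using jne j i0 vs(2) unfolding k l by (auto simp: doubleton_eq_iff nth_eq_iff_index_eq)
      then have "j = (i0 + 1) mod ?L" "(j + 1) mod ?L = i0"
        using j i0 vs(2) L by (auto simp: nth_eq_iff_index_eq)
      then show False using i0 j vs(1)
        by (cases "i0 + 1 = ?L"; cases "j + 1 = ?L") auto
    qed
    then have "?D (vs ! j) (vs ! ((j + 1) mod ?L))" using cyc[OF j] by (simp add: del_edge_def)
    moreover have "?D\<^sup>*\<^sup>* l (vs ! j)" using Suc unfolding j_def by simp
    ultimately show ?case unfolding j'[symmetric] by (rule rtranclp.rtrancl_into_rtrancl[rotated])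
  qed
  have "(i0 + 1 + (?L - 1)) mod ?L = i0" using L i0 by (simp add: mod_if)
  then have lk: "?D\<^sup>*\<^sup>* l k" using walk[of "?L - 1"] by (simp add: k)
  then have kl: "?D\<^sup>*\<^sup>* k l" using rtranclp_sym[OF simple_graph_del_edge[OF G]] by blast
  have one: "?D\<^sup>*\<^sup>* a b" if ab: "E a b" for a b
  proof (cases "{a, b} = {k, l}")
    case True
    then show ?thesis using lk kl by (metis doubleton_eq_iff)
  next
    case False
    then have "?D a b" using ab by (simp add: del_edge_def)
    then show ?thesis by (rule r_into_rtranclp)
  qed
  have "?D\<^sup>*\<^sup>* a b" if "E\<^sup>*\<^sup>* a b" for a b
    using that
  proof (induction rule: rtranclp_induct)
    case (step y z)
    then show ?case using one[of y z] by (meson rtranclp_trans)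
  qed simp
  then show ?thesis using conn by (simp add: connected_graph_def)
qed

text \<open>The parent of a vertex is a neighbour closer to the root. An edge that is no parent edge
  could be deleted and every vertex would still reach the root, whereas all edges are bridges. The
  last conjunct excludes mutual parents, so that no edge is counted twice.\<close>

lemma tree_parent:
  assumes G: "simple_graph n E" and conn: "connected_graph n E"
    and ac: "\<And>C. \<not> cycle_edge_set n E C" and r: "r < n"
  shows "\<exists>\<pi>. (\<forall>i<n. i \<noteq> r \<longrightarrow> E i (\<pi> i)) \<and>
    (\<forall>i j. E i j \<longrightarrow> (i \<noteq> r \<and> j = \<pi> i) \<or> (j \<noteq> r \<and> i = \<pi> j)) \<and>
    (\<forall>i<n. \<forall>j<n. \<not> ((i \<noteq> r \<and> j = \<pi> i) \<and> (j \<noteq> r \<and> i = \<pi> j)))"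
proof -
  define d where "d = (\<lambda>v. LEAST m. (E ^^ m) v r)"
  have ex: "\<exists>w. E v w \<and> d w < d v" if v: "v < n" "v \<noteq> r" for v
  proof -
    have "\<exists>m. (E ^^ m) v r"
      using conn v r by (meson connected_graph_def rtranclp_imp_relpowp)
    then have dv: "(E ^^ d v) v r" unfolding d_def by (rule LeastI_ex)
    then obtain m where m: "d v = Suc m" using v(2) by (cases "d v") auto
    then obtain w where w: "E v w" "(E ^^ m) w r" using dv by (metis relpowp_Suc_D2)
    then have "d w \<le> m" unfolding d_def by (intro Least_le)
    then show ?thesis using w m by auto
  qed
  define \<pi> where "\<pi> = (\<lambda>v. SOME w. E v w \<and> d w < d v)"
  have \<pi>: "E v (\<pi> v)" "d (\<pi> v) < d v" if "v < n" "v \<noteq> r" for v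
    using someI_ex[OF ex[OF that]] by (auto simp: \<pi>_def)
  have "(i \<noteq> r \<and> j = \<pi> i) \<or> (j \<noteq> r \<and> i = \<pi> j)" if ij: "E i j" for i j
  proof (rule ccontr)
    assume neg: "\<not> ?thesis"
    let ?D = "del_edge E i j"
    have step: "?D v (\<pi> v)" if "v < n" "v \<noteq> r" for v
      using \<pi>(1)[OF that] neg that by (auto simp: del_edge_def doubleton_eq_iff)
    have to_root: "?D\<^sup>*\<^sup>* v r" if "v < n" for v
      using that
    proof (induction "d v" arbitrary: v rule: less_induct)
      case less
      show ?case
      proof (cases "v = r")
        case False
        have "\<pi> v < n" using \<pi>(1)[OF less(2) False] G by (simp add: simple_graph_def)
        then have "?D\<^sup>*\<^sup>* (\<pi> v) r" using less(1) \<pi>(2)[OF less(2) False] by blast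
        then show ?thesis using step[OF less(2) False] by (rule converse_rtranclp_into_rtranclp[rotated])
      qed simp
    qed
    have "i < n" "j < n" using ij G by (auto simp: simple_graph_def)
    then have "?D\<^sup>*\<^sup>* i j"
      using to_root rtranclp_sym[OF simple_graph_del_edge[OF G]] by (meson rtranclp_trans)
    then show False using acyclic_edge_is_bridge[OF G ac ij] by blast
  qed
  moreover have "\<not> ((i \<noteq> r \<and> j = \<pi> i) \<and> (j \<noteq> r \<and> i = \<pi> j))" if "i < n" "j < n" for i j
    using \<pi>(2)[of i] \<pi>(2)[of j] that by auto
  ultimately show ?thesis using \<pi>(1) by (intro exI[of _ \<pi>]) simp
qed

text \<open>Every edge joins exactly one non-root vertex to its parent, so a symmetric sum over
  edges becomes a sum over the non-root vertices.\<close>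

lemma tree_parent_sum:
  assumes G: "simple_graph n E" and conn: "connected_graph n E"
    and ac: "\<And>C. \<not> cycle_edge_set n E C" and r: "r < n"
  shows "\<exists>\<pi>. (\<forall>i<n. i \<noteq> r \<longrightarrow> E i (\<pi> i)) \<and>
    (\<forall>i j. E i j \<longrightarrow> (i \<noteq> r \<and> j = \<pi> i) \<or> (j \<noteq> r \<and> i = \<pi> j)) \<and>
    (\<forall>w :: nat \<Rightarrow> nat \<Rightarrow> real. (\<forall>i j. w i j = w j i) \<longrightarrow>
      adj_sum n E w = 2 * (\<Sum>i\<in>{..<n} - {r}. w i (\<pi> i)))"
proof -
  obtain \<pi> where \<pi>': "(\<forall>i<n. i \<noteq> r \<longrightarrow> E i (\<pi> i)) \<and>
    (\<forall>i j. E i j \<longrightarrow> (i \<noteq> r \<and> j = \<pi> i) \<or> (j \<noteq> r \<and> i = \<pi> j)) \<and>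
    (\<forall>i<n. \<forall>j<n. \<not> ((i \<noteq> r \<and> j = \<pi> i) \<and> (j \<noteq> r \<and> i = \<pi> j)))"
    using tree_parent[OF G conn ac r] by (rule exE)
  have \<pi>: "\<And>i. i < n \<Longrightarrow> i \<noteq> r \<Longrightarrow> E i (\<pi> i)"
    "\<And>i j. E i j \<Longrightarrow> (i \<noteq> r \<and> j = \<pi> i) \<or> (j \<noteq> r \<and> i = \<pi> j)"
    "\<And>i j. i < n \<Longrightarrow> j < n \<Longrightarrow> \<not> ((i \<noteq> r \<and> j = \<pi> i) \<and> (j \<noteq> r \<and> i = \<pi> j))"
    using \<pi>' by simp_all
  have lt: "\<pi> i < n" if "i < n" "i \<noteq> r" for i using \<pi>(1)[OF that] G by (simp add: simple_graph_def)
  have "adj_sum n E w = 2 * (\<Sum>i\<in>{..<n} - {r}. w i (\<pi> i))" if w: "\<And>i j. w i j = w j i"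
    for w :: "nat \<Rightarrow> nat \<Rightarrow> real"
  proof -
    let ?g = "\<lambda>i j. if i \<noteq> r \<and> j = \<pi> i then w i j else 0"
    have S: "(\<Sum>i<n. \<Sum>j<n. ?g i j) = (\<Sum>i\<in>{..<n} - {r}. w i (\<pi> i))"
    proof -
      have "(\<Sum>j<n. ?g i j) = (if i \<noteq> r then w i (\<pi> i) else 0)" if "i < n" for i
        using lt[OF that] by (cases "i = r") auto
      then have "(\<Sum>i<n. \<Sum>j<n. ?g i j) = (\<Sum>i<n. if i \<noteq> r then w i (\<pi> i) else 0)" by simp
      also have "\<dots> = (\<Sum>i\<in>{..<n} - {r}. w i (\<pi> i))"
        by (rule sum.mono_neutral_cong_right) auto
      finally show ?thesis .
    qed
    have iff: "E i j \<longleftrightarrow> (i \<noteq> r \<and> j = \<pi> i) \<or> (j \<noteq> r \<and> i = \<pi> j)" if "i < n" "j < n" for i j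
      using \<pi>(1)[of i] \<pi>(1)[of j] \<pi>(2)[of i j] that G by (metis simple_graph_def)
    have "(if E i j then w i j else 0) = ?g i j + ?g j i" if "i < n" "j < n" for i j
    proof -
      have wji: "w j i = w i j" by (rule w)
      show ?thesis unfolding iff[OF that] wji using \<pi>(3)[OF that] by argo
    qed
    then have "adj_sum n E w = (\<Sum>i<n. \<Sum>j<n. ?g i j + ?g j i)"
      unfolding adj_sum_def by (intro sum.cong refl) simp
    also have "\<dots> = (\<Sum>i<n. \<Sum>j<n. ?g i j) + (\<Sum>i<n. \<Sum>j<n. ?g j i)" by (simp only: sum.distrib)
    also have "(\<Sum>i<n. \<Sum>j<n. ?g j i) = (\<Sum>j<n. \<Sum>i<n. ?g j i)" by (rule sum.swap)
    finally show ?thesis using S by simp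
  qed
  then show ?thesis using \<pi>(1,2) by (intro exI[of _ \<pi>]) simp
qed

text \<open>Deleting an edge of the only cycle leaves no cycle. All edges of \<open>vs\<close> are
  covered because the edge is chosen later, by the signs of an eigenvector.\<close>

lemma unicyclic_decomp:
  assumes U: "unicyclic n E"
  obtains vs where "3 \<le> length vs" "distinct vs" "set vs \<subseteq> {0..<n}"
    "\<And>i. i < length vs \<Longrightarrow> E (vs ! i) (vs ! ((i + 1) mod length vs))"
    "\<And>i k l. i < length vs \<Longrightarrow> k = vs ! i \<Longrightarrow> l = vs ! ((i + 1) mod length vs) \<Longrightarrow>
       connected_graph n (del_edge E k l) \<and> (\<forall>C. \<not> cycle_edge_set n (del_edge E k l) C)"
proof -
  have G: "simple_graph n E" and conn: "connected_graph n E" and "card {C. cycle_edge_set n E C} = 1"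
    using U by (auto simp: unicyclic_def)
  then obtain C0 where C0: "{C. cycle_edge_set n E C} = {C0}" by (meson card_1_singletonE)
  then have "cycle_edge_set n E C0" by blast
  then obtain vs where vs: "3 \<le> length vs" "distinct vs" "set vs \<subseteq> {0..<n}"
    "\<forall>i<length vs. E (vs ! i) (vs ! ((i + 1) mod length vs))"
    "C0 = {{vs ! i, vs ! ((i + 1) mod length vs)} | i. i < length vs}"
    unfolding cycle_edge_set_def by blast
  have "connected_graph n (del_edge E k l) \<and> (\<forall>C. \<not> cycle_edge_set n (del_edge E k l) C)"
    if i: "i < length vs" and k: "k = vs ! i" and l: "l = vs ! ((i + 1) mod length vs)" for i k l
  proof
    show "connected_graph n (del_edge E k l)"
      by (rule del_cycle_edge_connected[OF G conn vs(1,2) _ i k l]) (use vs(4) in blast)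
    show "\<forall>C. \<not> cycle_edge_set n (del_edge E k l) C"
    proof (intro allI notI)
      fix C assume C: "cycle_edge_set n (del_edge E k l) C"
      then have "cycle_edge_set n E C" unfolding cycle_edge_set_def del_edge_def by blast
      then have "C = C0" using C0 by blast
      moreover have "{k, l} \<in> C0" using i vs(5) k l by blast
      moreover have "{k, l} \<notin> C" using C unfolding cycle_edge_set_def del_edge_def by auto
      ultimately show False by blast
    qed
  qed
  then show ?thesis using that vs by blast
qed

section \<open>Edge sums of a signed tree\<close>

definition restr :: "nat set \<Rightarrow> nat set \<Rightarrow> (nat \<Rightarrow> real) \<Rightarrow> nat \<Rightarrow> nat \<Rightarrow> real" where
  "restr P Q x i j = (if i \<in> P \<and> j \<in> Q then x i * x j else 0)"

definition is_tree :: "nat \<Rightarrow> (nat \<Rightarrow> nat \<Rightarrow> bool) \<Rightarrow> bool" where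
  "is_tree n H \<longleftrightarrow> simple_graph n H \<and> connected_graph n H \<and> (\<forall>C. \<not> cycle_edge_set n H C)"

text \<open>Root the tree at \<open>r\<close>. A vertex \<open>i\<close> of \<open>P\<close> other
  than \<open>r\<close> contributes at most \<open>u i * u r\<close>, as in a star centred at
  \<open>r\<close>: its parent lies outside \<open>P\<close> or has entry at most
  \<open>u r\<close>. Equality with strict entries forces every parent to be
  \<open>r\<close>.\<close>

lemma adj_sum_star_bound:
  assumes T: "is_tree n H" and P: "P \<subseteq> {..<n}" "r \<in> P"
    and u: "\<And>i. i \<in> P \<Longrightarrow> 0 \<le> u i" "\<And>i. i \<in> P \<Longrightarrow> u i \<le> u r"
  shows "adj_sum n H (restr P P u) \<le> 2 * u r * (sum u P - u r)"
    and "\<lbrakk>adj_sum n H (restr P P u) = 2 * u r * (sum u P - u r);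
       \<And>i. i \<in> P \<Longrightarrow> 0 < u i; \<And>i. i \<in> P \<Longrightarrow> i \<noteq> r \<Longrightarrow> u i < u r; i \<in> P; j \<in> P\<rbrakk>
       \<Longrightarrow> H i j \<longleftrightarrow> i \<noteq> j \<and> (i = r \<or> j = r)"
proof -
  have G: "simple_graph n H" using T by (simp add: is_tree_def)
  have rn: "r < n" using P by auto
  obtain \<pi> where \<pi>: "(\<forall>i<n. i \<noteq> r \<longrightarrow> H i (\<pi> i)) \<and>
    (\<forall>i j. H i j \<longrightarrow> (i \<noteq> r \<and> j = \<pi> i) \<or> (j \<noteq> r \<and> i = \<pi> j)) \<and>
    (\<forall>w :: nat \<Rightarrow> nat \<Rightarrow> real. (\<forall>i j. w i j = w j i) \<longrightarrow>
      adj_sum n H w = 2 * (\<Sum>i\<in>{..<n} - {r}. w i (\<pi> i)))"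
    using tree_parent_sum[of n H r] T rn unfolding is_tree_def by blast
  let ?f = "\<lambda>i. restr P P u i (\<pi> i)"
  let ?b = "\<lambda>i. if i \<in> P then u i * u r else 0"
  have "restr P P u i j = restr P P u j i" for i j by (simp add: restr_def mult.commute)
  then have S: "adj_sum n H (restr P P u) = 2 * (\<Sum>i\<in>{..<n} - {r}. ?f i)" using \<pi> by blast
  have fb: "?f i \<le> ?b i" for i using u[of i] u[of "\<pi> i"] u(1)[OF P(2)]
    by (auto simp: restr_def mult_left_mono)
  have "(\<Sum>i\<in>{..<n} - {r}. ?b i) = (\<Sum>i\<in>P - {r}. u i * u r)"
    using P by (intro sum.mono_neutral_cong_right) auto
  also have "\<dots> = (sum u P - u r) * u r"
    using P finite_subset[OF P(1)] by (simp add: sum_distrib_right[symmetric] sum_diff1)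
  finally have B: "2 * (\<Sum>i\<in>{..<n} - {r}. ?b i) = 2 * u r * (sum u P - u r)" by simp
  show "adj_sum n H (restr P P u) \<le> 2 * u r * (sum u P - u r)"
    unfolding S B[symmetric] by (intro mult_left_mono sum_mono fb) auto
  assume eq: "adj_sum n H (restr P P u) = 2 * u r * (sum u P - u r)"
    and pos: "\<And>i. i \<in> P \<Longrightarrow> 0 < u i" and strict: "\<And>i. i \<in> P \<Longrightarrow> i \<noteq> r \<Longrightarrow> u i < u r"
    and ij: "i \<in> P" "j \<in> P"
  have par: "\<pi> i = r" if i: "i \<in> P" "i \<noteq> r" for i
  proof (rule ccontr)
    assume ne: "\<pi> i \<noteq> r"
    have "?f i < ?b i"
      using i ne pos[OF i(1)] pos[OF P(2)] strict[of "\<pi> i"] by (auto simp: restr_def)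
    then have "(\<Sum>i\<in>{..<n} - {r}. ?f i) < (\<Sum>i\<in>{..<n} - {r}. ?b i)"
      using i P fb by (intro sum_strict_mono_ex1) auto
    then show False using eq S B by simp
  qed
  have "H v r" if "v \<in> P" "v \<noteq> r" for v using \<pi> par[OF that] that P by force
  moreover have "H v w = H w v" "\<not> H v v" for v w using G by (auto simp: simple_graph_def)
  moreover have "i = r \<or> j = r" if "H i j" using \<pi> par ij that by metis
  ultimately show "H i j \<longleftrightarrow> i \<noteq> j \<and> (i = r \<or> j = r)" using ij by metis
qed

lemma crossing_edge_exists:
  assumes "simple_graph n H" "connected_graph n H" "P \<union> N = {..<n}" "P \<inter> N = {}" "a \<in> P" "b \<in> N"
  obtains i j where "i \<in> P" "j \<in> N" "H i j"
proof -
  have "a < n" "b < n" using assms(3,5,6) by blast+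
  then have ab: "H\<^sup>*\<^sup>* a b" using assms(2) by (simp add: connected_graph_def)
  have "b \<in> P \<or> (\<exists>i\<in>P. \<exists>j\<in>N. H i j)" using ab
  proof (induction rule: rtranclp_induct)
    case (step y z)
    have "z < n" using step(2) assms(1) by (simp add: simple_graph_def)
    then show ?case using step assms(3) by blast
  qed (use assms(5) in blast)
  then show ?thesis using that assms(4,6) by blast
qed

text \<open>All crossing products are non-positive, so keeping a single edge, in both orientations,
  can only increase the sum.\<close>

lemma adj_sum_crossing_bound:
  assumes G: "simple_graph n H" and PN: "P \<union> N = {..<n}" "P \<inter> N = {}"
    and x: "\<And>i. i \<in> P \<Longrightarrow> 0 \<le> x i" "\<And>i. i \<in> N \<Longrightarrow> x i \<le> 0"
    and ab: "a \<in> P" "b \<in> N" "H a b"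
  shows "adj_sum n H (\<lambda>i j. restr P N x i j + restr N P x i j) \<le> 2 * (x a * x b)"
proof -
  let ?w = "\<lambda>i j. restr P N x i j + restr N P x i j"
  let ?f = "\<lambda>(i, j). if H i j then ?w i j else 0"
  have nonpos: "?f z \<le> 0" for z
    using x by (cases z) (auto simp: restr_def mult_nonneg_nonpos mult_nonpos_nonneg add_nonpos_nonpos)
  have lt: "a < n" "b < n" "a \<noteq> b" "H b a" using G ab(3) by (auto simp: simple_graph_def)
  have "adj_sum n H ?w = sum ?f ({..<n} \<times> {..<n})"
    unfolding adj_sum_def by (simp add: sum.cartesian_product)
  also have "\<dots> = sum ?f ({..<n} \<times> {..<n} - {(a, b), (b, a)}) + sum ?f {(a, b), (b, a)}"
    using lt by (intro sum.subset_diff) auto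
  also have "\<dots> \<le> sum ?f {(a, b), (b, a)}" using sum_nonpos[of _ ?f] nonpos by force
  also have "\<dots> = 2 * (x a * x b)"
    using lt ab PN by (auto simp: restr_def)
  finally show ?thesis .
qed

lemma adj_sum_add: "adj_sum n H (\<lambda>i j. v i j + w i j) = adj_sum n H v + adj_sum n H w"
  unfolding adj_sum_def sum.distrib[symmetric] by (intro sum.cong refl) auto

text \<open>Negating both factors on \<open>N\<close> keeps the products and makes the entries
  non-negative, as the star bound requires.\<close>

lemma adj_sum_split:
  assumes G: "simple_graph n H" and PN: "P \<union> N = {..<n}" "P \<inter> N = {}"
  shows "adj_sum n H (\<lambda>i j. x i * x j) = adj_sum n H (restr P P x) + adj_sum n H (restr N N (\<lambda>i. - x i))
     + adj_sum n H (\<lambda>i j. restr P N x i j + restr N P x i j)"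
  unfolding adj_sum_add[symmetric]
  unfolding adj_sum_def using PN
  by (intro sum.cong refl) (auto simp: restr_def)

lemma adj_sum_del_edge:
  assumes G: "simple_graph n E" and kl: "E k l"
  shows "adj_sum n E (\<lambda>i j. x i * x j) = adj_sum n (del_edge E k l) (\<lambda>i j. x i * x j) + 2 * (x k * x l)"
proof -
  let ?D = "del_edge E k l"
  have lt: "k < n" "l < n" "k \<noteq> l" "E l k" using assms by (auto simp: simple_graph_def)
  have kl_sum: "(\<Sum>i<n. \<Sum>j<n. if i = a \<and> j = b then c else 0) = c" if "a < n" "b < n" for a b and c :: real
  proof -
    have "(\<Sum>j<n. if i = a \<and> j = b then c else 0) = (if i = a then c else 0)" for i
      using that(2) by (cases "i = a") auto
    then show ?thesis using that(1) by simp
  qed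
  have "adj_sum n E (\<lambda>i j. x i * x j) = (\<Sum>i<n. \<Sum>j<n. (if ?D i j then x i * x j else 0)
     + (if i = k \<and> j = l then x k * x l else 0) + (if i = l \<and> j = k then x k * x l else 0))"
    unfolding adj_sum_def using lt kl
    by (intro sum.cong refl) (auto simp: del_edge_def doubleton_eq_iff)
  also have "\<dots> = adj_sum n ?D (\<lambda>i j. x i * x j) + x k * x l + x k * x l"
    unfolding sum.distrib adj_sum_def using lt by (simp add: kl_sum)
  finally show ?thesis by simp
qed

text \<open>\<open>r1\<close>, \<open>r2\<close> carry the entries of largest modulus in
  \<open>P\<close>, \<open>N\<close>, and \<open>i0\<close>, \<open>j0\<close> those of smallest
  modulus; ties and coincidences are allowed.\<close>

locale signed_tree =
  fixes n :: nat and H :: "nat \<Rightarrow> nat \<Rightarrow> bool" and P N :: "nat set" and x :: "nat \<Rightarrow> real"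
    and r1 i0 r2 j0 :: nat
  assumes T: "is_tree n H" and PN: "P \<union> N = {..<n}" "P \<inter> N = {}"
    and mem: "r1 \<in> P" "i0 \<in> P" "r2 \<in> N" "j0 \<in> N"
    and P: "\<And>i. i \<in> P \<Longrightarrow> 0 \<le> x i" "\<And>i. i \<in> P \<Longrightarrow> x i \<le> x r1" "\<And>i. i \<in> P \<Longrightarrow> x i0 \<le> x i"
    and N: "\<And>i. i \<in> N \<Longrightarrow> x i \<le> 0" "\<And>i. i \<in> N \<Longrightarrow> x r2 \<le> x i" "\<And>i. i \<in> N \<Longrightarrow> x i \<le> x j0"
begin

lemma simple_H: "simple_graph n H" using T by (simp add: is_tree_def)

lemma P_part: "adj_sum n H (restr P P x) \<le> 2 * x r1 * (sum x P - x r1)"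
  by (rule adj_sum_star_bound(1)[OF T]) (use PN mem P in auto)

lemma N_part: "adj_sum n H (restr N N (\<lambda>i. - x i)) \<le> 2 * x r2 * (sum x N - x r2)"
  using adj_sum_star_bound(1)[OF T, of N r2 "\<lambda>i. - x i"] PN mem N
  by (auto simp: sum_negf algebra_simps)

lemma cross_part:
  assumes "a \<in> P" "b \<in> N" "H a b"
  shows "adj_sum n H (\<lambda>i j. restr P N x i j + restr N P x i j) \<le> 2 * (x a * x b)"
  by (rule adj_sum_crossing_bound[OF simple_H PN _ _ assms]) (use P N in auto)

text \<open>Crossing products are non-positive, so the smallest moduli give the largest
  product.\<close>

lemma cross_weight:
  assumes "a \<in> P" "b \<in> N"
  shows "x a * x b \<le> x i0 * x j0"
proof -
  have "x a * x b \<le> x i0 * x b" using P(3)[OF assms(1)] N(1)[OF assms(2)] by (rule mult_right_mono_neg)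
  also have "\<dots> \<le> x i0 * x j0" using N(3)[OF assms(2)] P(1)[OF mem(2)] by (rule mult_left_mono)
  finally show ?thesis .
qed

lemma crossing_exists: obtains a b where "a \<in> P" "b \<in> N" "H a b"
  using crossing_edge_exists[OF simple_H _ PN mem(1,3)] T unfolding is_tree_def by blast

text \<open>The right-hand side is the value on two stars, centred at \<open>r1\<close> and
  \<open>r2\<close>, joined by the edge from \<open>i0\<close> to \<open>j0\<close>.\<close>

lemma sum_bound:
  "adj_sum n H (\<lambda>i j. x i * x j)
    \<le> 2 * x r1 * (sum x P - x r1) + 2 * x r2 * (sum x N - x r2) + 2 * (x i0 * x j0)"
proof -
  obtain a b where ab: "a \<in> P" "b \<in> N" "H a b" using crossing_exists .
  show ?thesis
    using P_part N_part cross_part[OF ab] cross_weight[OF ab(1,2)] adj_sum_split[OF simple_H PN, of x] by linarith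
qed

text \<open>Equality makes each of the three partial bounds tight; the strict order of the entries
  then leaves only the two stars and the joining edge.\<close>

lemma sum_bound_eq:
  assumes eq: "adj_sum n H (\<lambda>i j. x i * x j)
    = 2 * x r1 * (sum x P - x r1) + 2 * x r2 * (sum x N - x r2) + 2 * (x i0 * x j0)"
    and pos: "0 < x i0" and neg: "x j0 < 0"
    and sP: "\<And>i. i \<in> P \<Longrightarrow> i \<noteq> r1 \<Longrightarrow> x i < x r1" "\<And>i. i \<in> P \<Longrightarrow> i \<noteq> i0 \<Longrightarrow> x i0 < x i"
    and sN: "\<And>i. i \<in> N \<Longrightarrow> i \<noteq> r2 \<Longrightarrow> x r2 < x i" "\<And>i. i \<in> N \<Longrightarrow> i \<noteq> j0 \<Longrightarrow> x i < x j0"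
    and ij: "i < n" "j < n"
  shows "H i j \<longleftrightarrow> i \<noteq> j \<and> (i \<in> P \<and> j \<in> P \<and> (i = r1 \<or> j = r1) \<or> i \<in> N \<and> j \<in> N \<and> (i = r2 \<or> j = r2)
    \<or> {i, j} = {i0, j0})"
proof -
  obtain a b where ab: "a \<in> P" "b \<in> N" "H a b" using crossing_exists .
  have cr: "adj_sum n H (\<lambda>i j. restr P N x i j + restr N P x i j) \<le> 2 * (x i0 * x j0)"
    using cross_part[OF ab] cross_weight[OF ab(1,2)] by linarith
  have eqP: "adj_sum n H (restr P P x) = 2 * x r1 * (sum x P - x r1)"
    and eqN: "adj_sum n H (restr N N (\<lambda>i. - x i)) = 2 * x r2 * (sum x N - x r2)"
    and eqC: "adj_sum n H (\<lambda>i j. restr P N x i j + restr N P x i j) = 2 * (x i0 * x j0)"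
    using eq P_part N_part cr adj_sum_split[OF simple_H PN, of x] by linarith+
  have posP: "0 < x i" if "i \<in> P" for i using P(3)[OF that] pos by linarith
  have negN: "x i < 0" if "i \<in> N" for i using N(3)[OF that] neg by linarith
  have HP: "H i j \<longleftrightarrow> i \<noteq> j \<and> (i = r1 \<or> j = r1)" if "i \<in> P" "j \<in> P" for i j
    by (rule adj_sum_star_bound(2)[OF T _ mem(1) _ _ eqP]) (use PN P posP sP that in auto)
  have HN: "H i j \<longleftrightarrow> i \<noteq> j \<and> (i = r2 \<or> j = r2)" if "i \<in> N" "j \<in> N" for i j
    by (rule adj_sum_star_bound(2)[OF T _ mem(3), of "\<lambda>i. - x i"])
      (use PN N negN sN that eqN in \<open>auto simp: sum_negf algebra_simps\<close>)
  \<comment> \<open>Any other crossing edge would by itself push the crossing sum strictly below its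
    tight value.\<close>
  have HC: "i = i0 \<and> j = j0" if ij: "i \<in> P" "j \<in> N" "H i j" for i j
  proof (rule ccontr)
    assume "\<not> ?thesis"
    then have "x i * x j < x i0 * x j0"
    proof (cases "i = i0")
      case True
      then have "x j < x j0" using sN(2)[OF ij(2)] \<open>\<not> (i = i0 \<and> j = j0)\<close> by blast
      then show ?thesis using True pos by simp
    next
      case False
      then have "x i * x j < x i0 * x j" using sP(2)[OF ij(1)] negN[OF ij(2)] by simp
      also have "\<dots> \<le> x i0 * x j0" using cross_weight[OF mem(2) ij(2)] .
      finally show ?thesis .
    qed
    then show False using cross_part[OF ij] eqC by linarith
  qed
  have H0: "H i0 j0" using HC[OF ab] ab(3) by simp
  have sym: "H v w = H w v" for v w using simple_H by (auto simp: simple_graph_def)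
  have ne: "i0 \<noteq> j0" "i0 \<notin> N" "j0 \<notin> P" using mem PN by auto
  consider "i \<in> P" "j \<in> P" | "i \<in> N" "j \<in> N" | "i \<in> P" "j \<in> N" | "i \<in> N" "j \<in> P"
    using ij PN by blast
  then show ?thesis
  proof cases
    case 1
    then show ?thesis using HP[OF 1] ne PN(2) by (auto simp: doubleton_eq_iff)
  next
    case 2
    then show ?thesis using HN[OF 2] ne PN(2) by (auto simp: doubleton_eq_iff)
  next
    case 3
    then have "i \<noteq> j" "i \<notin> N" "j \<notin> P" using PN(2) by auto
    then show ?thesis using HC[OF 3] H0 ne 3 by (auto simp: doubleton_eq_iff)
  next
    case 4
    then have "i \<noteq> j" "i \<notin> P" "j \<notin> N" using PN(2) by auto
    then show ?thesis using HC[OF 4(2,1)] sym[of i j] H0 ne 4 by (auto simp: doubleton_eq_iff)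
  qed
qed

end

section \<open>The eigenvalue equations of \<open>U(p,q)\<close>\<close>

lemma U_edge_iff:
  assumes "p \<ge> 1" "q \<ge> 3"
  shows "U_edge p q i j \<longleftrightarrow> i = 0 \<and> 1 \<le> j \<and> j \<le> p \<or> j = 0 \<and> 1 \<le> i \<and> i \<le> p
    \<or> i = p + 1 \<and> p + 2 \<le> j \<and> j \<le> p + q + 1 \<or> j = p + 1 \<and> p + 2 \<le> i \<and> i \<le> p + q + 1
    \<or> i = p + 2 \<and> j = p + 3 \<or> i = p + 3 \<and> j = p + 2
    \<or> i = 1 \<and> j = p + q + 1 \<or> i = p + q + 1 \<and> j = 1"
  using assms unfolding U_edge_def by (auto simp: doubleton_eq_iff)

lemma simple_graph_U_edge:
  assumes "p \<ge> 1" "q \<ge> 3"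
  shows "simple_graph (p + q + 2) (U_edge p q)"
  unfolding simple_graph_def U_edge_iff[OF assms] using assms by auto

lemma nbr_sum_set:
  assumes "\<And>j. E i j \<longleftrightarrow> j \<in> A" "A \<subseteq> {..<n}"
  shows "nbr_sum n E x i = sum x A"
  unfolding nbr_sum_def using assms by (intro sum.mono_neutral_cong_right) auto

lemma nbr_sum_U_edge:
  assumes pq: "p \<ge> 1" "q \<ge> 3"
  shows "nbr_sum (p + q + 2) (U_edge p q) y 0 = sum y {1..p}"
    "k \<in> {2..p} \<Longrightarrow> nbr_sum (p + q + 2) (U_edge p q) y k = y 0"
    "nbr_sum (p + q + 2) (U_edge p q) y (Suc 0) = y 0 + y (p + q + 1)"
    "nbr_sum (p + q + 2) (U_edge p q) y (p + 1) = sum y {p + 2..p + q + 1}"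
    "nbr_sum (p + q + 2) (U_edge p q) y (p + 2) = y (p + 1) + y (p + 3)"
    "nbr_sum (p + q + 2) (U_edge p q) y (p + 3) = y (p + 1) + y (p + 2)"
    "k \<in> {p + 4..p + q} \<Longrightarrow> nbr_sum (p + q + 2) (U_edge p q) y k = y (p + 1)"
    "nbr_sum (p + q + 2) (U_edge p q) y (p + q + 1) = y (p + 1) + y 1"
proof -
  note iff = U_edge_iff[OF pq]
  let ?s = "nbr_sum (p + q + 2) (U_edge p q) y"
  show "?s 0 = sum y {1..p}" by (rule nbr_sum_set) (use pq in \<open>auto simp: iff\<close>)
  show "?s (p + 1) = sum y {p + 2..p + q + 1}" by (rule nbr_sum_set) (use pq in \<open>auto simp: iff\<close>)
  have "?s (Suc 0) = sum y {0, p + q + 1}" by (rule nbr_sum_set) (use pq in \<open>auto simp: iff\<close>)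
  then show "?s (Suc 0) = y 0 + y (p + q + 1)" by simp
  have "?s (p + 2) = sum y {p + 1, p + 3}" by (rule nbr_sum_set) (use pq in \<open>auto simp: iff\<close>)
  then show "?s (p + 2) = y (p + 1) + y (p + 3)" by simp
  have "?s (p + 3) = sum y {p + 1, p + 2}" by (rule nbr_sum_set) (use pq in \<open>auto simp: iff\<close>)
  then show "?s (p + 3) = y (p + 1) + y (p + 2)" by simp
  have "?s (p + q + 1) = sum y {p + 1, 1}" by (rule nbr_sum_set) (use pq in \<open>auto simp: iff\<close>)
  then show "?s (p + q + 1) = y (p + 1) + y 1" using pq by simp
  { assume "k \<in> {2..p}"
    then have "?s k = sum y {0}" using pq by (intro nbr_sum_set) (auto simp: iff)
    then show "?s k = y 0" by simp }
  { assume "k \<in> {p + 4..p + q}"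
    then have "?s k = sum y {p + 1}" using pq by (intro nbr_sum_set) (auto simp: iff)
    then show "?s k = y (p + 1)" by simp }
qed

lemma sum_left_pendants:
  fixes y :: "nat \<Rightarrow> real"
  assumes "p \<ge> (1::nat)"
  shows "sum y {1..p} = y 1 + sum y {2..p}"
  using assms by (simp add: sum.atLeast_Suc_atMost numeral_2_eq_2)

lemma sum_right_pendants:
  fixes y :: "nat \<Rightarrow> real"
  assumes "q \<ge> (3::nat)"
  shows "sum y {p + 2..p + q + 1} = y (p + 2) + y (p + 3) + sum y {p + 4..p + q} + y (p + q + 1)"
proof -
  have "{p + 2..p + q + 1} = {p + 2, p + 3} \<union> {p + 4..p + q} \<union> {p + q + 1}" using assms by auto
  then show ?thesis using assms by (simp add: sum.union_disjoint)
qed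

lemma sum_all_vertices:
  fixes y :: "nat \<Rightarrow> real"
  shows "sum y {..<p + q + 2} = y 0 + sum y {1..p} + y (p + 1) + sum y {p + 2..p + q + 1}"
proof -
  have "{..<p + q + 2} = {0} \<union> {1..p} \<union> {p + 1} \<union> {p + 2..p + q + 1}" by auto
  then show ?thesis by (simp add: sum.union_disjoint)
qed

lemma adj_sum_U_edge:
  assumes pq: "p \<ge> 1" "q \<ge> 3"
  shows "adj_sum (p + q + 2) (U_edge p q) (\<lambda>i j. y i * y j)
    = 2 * (y 0 * sum y {1..p} + y (p + 1) * sum y {p + 2..p + q + 1} + y (p + 2) * y (p + 3)
        + y 1 * y (p + q + 1))"
proof -
  let ?s = "nbr_sum (p + q + 2) (U_edge p q) y"
  have "adj_sum (p + q + 2) (U_edge p q) (\<lambda>i j. y i * y j) = (\<Sum>i<p + q + 2. y i * ?s i)"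
    unfolding adj_sum_def nbr_sum_def sum_distrib_left by (intro sum.cong) auto
  also have "\<dots> = y 0 * ?s 0 + (y 1 * ?s 1 + (\<Sum>i\<in>{2..p}. y i * ?s i)) + y (p + 1) * ?s (p + 1)
      + (y (p + 2) * ?s (p + 2) + y (p + 3) * ?s (p + 3) + (\<Sum>i\<in>{p + 4..p + q}. y i * ?s i)
        + y (p + q + 1) * ?s (p + q + 1))"
    by (simp only: sum_all_vertices sum_left_pendants[OF pq(1)] sum_right_pendants[OF pq(2)])
  also have "(\<Sum>i\<in>{2..p}. y i * ?s i) = y 0 * sum y {2..p}"
    unfolding sum_distrib_left by (intro sum.cong refl) (simp only: nbr_sum_U_edge(2)[OF pq] mult.commute)
  also have "(\<Sum>i\<in>{p + 4..p + q}. y i * ?s i) = y (p + 1) * sum y {p + 4..p + q}"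
    unfolding sum_distrib_left by (intro sum.cong refl) (simp only: nbr_sum_U_edge(7)[OF pq] mult.commute)
  finally show ?thesis
    unfolding nbr_sum_U_edge(1,4,5,6,8)[OF pq] nbr_sum_U_edge(3)[OF pq, folded One_nat_def]
      sum_left_pendants[OF pq(1)] sum_right_pendants[OF pq(2)]
    by (simp add: algebra_simps)
qed

text \<open>Entries: \<open>a\<close> centre, \<open>b\<close> ordinary pendants and \<open>c\<close> joining pendant of the star
  \<open>K_{1,p}\<close>; \<open>d\<close> centre, \<open>e\<close> triangle vertices, \<open>f\<close> ordinary pendants and \<open>g\<close> joining
  pendant of \<open>S^3_{q+1}\<close>; \<open>s\<close> is the sum of all entries. For \<open>p = 1\<close> or \<open>q = 3\<close> the class of
  \<open>b\<close> or \<open>f\<close> is empty and the value is a dummy.\<close>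
definition class_eqs :: "real \<Rightarrow> real \<Rightarrow> real \<Rightarrow> real \<Rightarrow> real \<Rightarrow> real \<Rightarrow> real \<Rightarrow> real \<Rightarrow> real \<Rightarrow> real \<Rightarrow> real \<Rightarrow> bool" where
  "class_eqs p q m a b c d e f g s \<longleftrightarrow>
    (p - 1) * b + c = m * a + s \<and> a = m * b + s \<and> a + g = m * c + s \<and>
    2 * e + (q - 3) * f + g = m * d + s \<and> d + e = m * e + s \<and> d = m * f + s \<and> d + c = m * g + s \<and>
    s = a + (p - 1) * b + c + d + 2 * e + (q - 3) * f + g"

text \<open>Pendants with the same neighbour satisfy the same equation, hence share an entry. A
  non-zero vector has \<open>b\<close> or \<open>s\<close> non-zero because these two determine all
  other values.\<close>

lemma class_eqs_if_eigvec:
  assumes pq: "p \<ge> 1" "q \<ge> 3" and m: "m > 1"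
    and ev: "eigvec (p + q + 2) (U_edge p q) m y" and nz: "\<exists>i<p + q + 2. y i \<noteq> 0"
  shows "\<exists>b f. class_eqs p q m (y 0) b (y 1) (y (p + 1)) (y (p + 2)) f (y (p + q + 1)) (vsum (p + q + 2) y) \<and>
    (\<forall>k\<in>{2..p}. y k = b) \<and> y (p + 3) = y (p + 2) \<and> (\<forall>k\<in>{p + 4..p + q}. y k = f) \<and>
    (b \<noteq> 0 \<or> vsum (p + q + 2) y \<noteq> 0)"
proof -
  define s where "s = vsum (p + q + 2) y"
  \<comment> \<open>As formulas, \<open>b\<close> and \<open>f\<close> also make sense when their
    class is empty.\<close>
  define b where "b = (y 0 - s) / m"
  define f where "f = (y (p + 1) - s) / m"
  have E: "nbr_sum (p + q + 2) (U_edge p q) y k = m * y k + s" if "k < p + q + 2" for k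
    using ev that by (simp add: eigvec_def s_def)
  note nb = nbr_sum_U_edge[OF pq]
  have yb: "y k = b" if "k \<in> {2..p}" for k
    using E[of k] nb(2)[OF that] that m by (simp add: b_def field_simps)
  have yf: "y k = f" if "k \<in> {p + 4..p + q}" for k
    using E[of k] nb(7)[OF that] that m by (simp add: f_def field_simps)
  have e2: "y (p + 1) + y (p + 3) = m * y (p + 2) + s" and e3: "y (p + 1) + y (p + 2) = m * y (p + 3) + s"
    using E[of "p + 2"] E[of "p + 3"] nb(5,6) pq by simp_all
  \<comment> \<open>The two triangle vertices have symmetric equations, and \<open>m + 1\<close> is
    non-zero.\<close>
  have "(m + 1) * (y (p + 3) - y (p + 2)) = 0" using e2 e3 by (simp add: algebra_simps)
  then have ye: "y (p + 3) = y (p + 2)" using m by simp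
  have sl: "sum y {1..p} = y 1 + (real p - 1) * b"
    unfolding sum_left_pendants[OF pq(1)] using yb pq(1) by (simp add: of_nat_diff)
  have sr: "sum y {p + 2..p + q + 1} = 2 * y (p + 2) + (real q - 3) * f + y (p + q + 1)"
    unfolding sum_right_pendants[OF pq(2)] using yf pq(2) ye by (simp add: of_nat_diff)
  have eqs: "class_eqs p q m (y 0) b (y 1) (y (p + 1)) (y (p + 2)) f (y (p + q + 1)) s"
    unfolding class_eqs_def
  proof (intro conjI)
    show "(real p - 1) * b + y 1 = m * y 0 + s" using E[of 0] nb(1) sl by simp
    show "y 0 = m * b + s" "y (p + 1) = m * f + s" using m by (simp_all add: b_def f_def field_simps)
    show "y 0 + y (p + q + 1) = m * y 1 + s" using E[of 1] nb(3) by simp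
    show "2 * y (p + 2) + (real q - 3) * f + y (p + q + 1) = m * y (p + 1) + s"
      using E[of "p + 1"] nb(4) sr by simp
    show "y (p + 1) + y (p + 2) = m * y (p + 2) + s" using e2 ye by simp
    show "y (p + 1) + y 1 = m * y (p + q + 1) + s" using E[of "p + q + 1"] nb(8) by simp
    show "s = y 0 + (real p - 1) * b + y 1 + y (p + 1) + 2 * y (p + 2) + (real q - 3) * f + y (p + q + 1)"
      unfolding s_def vsum_def sum_all_vertices sl sr by simp
  qed
  \<comment> \<open>If \<open>b\<close> and \<open>s\<close> vanish, so do \<open>a\<close>,
    \<open>c\<close>, \<open>g\<close>, \<open>d\<close>, \<open>f\<close>, \<open>e\<close> in
    turn; the last uses \<open>m \<noteq> 1\<close>.\<close>
  have "b \<noteq> 0 \<or> s \<noteq> 0"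
  proof (rule ccontr)
    assume "\<not> ?thesis"
    then have z: "b = 0" "s = 0" by auto
    have h: "(real p - 1) * b + y 1 = m * y 0 + s" "y 0 = m * b + s" "y 0 + y (p + q + 1) = m * y 1 + s"
      "y (p + 1) + y 1 = m * y (p + q + 1) + s"
      using eqs unfolding class_eqs_def by blast+
    have a: "y 0 = 0" using h(2) z by simp
    have c: "y 1 = 0" using h(1) z a by simp
    have g: "y (p + q + 1) = 0" using h(3) z a c by simp
    have d: "y (p + 1) = 0" using h(4) z g c by simp
    have f: "f = 0" using z d by (simp add: f_def)
    have "(m - 1) * y (p + 2) = 0" using e2 ye d z by (simp add: algebra_simps)
    then have e: "y (p + 2) = 0" "y (p + 3) = 0" using m ye by auto
    have "y i = 0" if "i < p + q + 2" for i
    proof -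
      consider "i = 0" | "i = 1" | "i \<in> {2..p}" | "i = p + 1" | "i = p + 2" | "i = p + 3"
        | "i \<in> {p + 4..p + q}" | "i = p + q + 1" using \<open>i < p + q + 2\<close> by fastforce
      then show ?thesis using a c g d f e yb yf z by cases auto
    qed
    then show False using nz by blast
  qed
  then show ?thesis using eqs yb ye yf unfolding s_def by blast
qed

lemma eigvec_if_class_eqs:
  assumes pq: "p \<ge> 1" "q \<ge> 3" and m: "m > 1"
    and eqs: "class_eqs p q m a b c d e f g s" and nz: "b \<noteq> 0 \<or> s \<noteq> 0"
  shows "\<exists>y. eigvec (p + q + 2) (U_edge p q) m y \<and> (\<exists>i<p + q + 2. y i \<noteq> 0)"
proof -
  define y where "y = (\<lambda>k. if k = 0 then a else if k = 1 then c else if k \<le> p then b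
    else if k = p + 1 then d else if k \<le> p + 3 then e else if k \<le> p + q then f else g)"
  have y: "y 0 = a" "y 1 = c" "y (p + 1) = d" "y (p + 2) = e" "y (p + 3) = e" "y (p + q + 1) = g"
    using pq by (auto simp: y_def)
  have yb: "y k = b" if "k \<in> {2..p}" for k using that by (auto simp: y_def)
  have yf: "y k = f" if "k \<in> {p + 4..p + q}" for k using that by (auto simp: y_def)
  have sl: "sum y {1..p} = c + (real p - 1) * b"
    unfolding sum_left_pendants[OF pq(1)] using yb y pq(1) by (simp add: of_nat_diff)
  have sr: "sum y {p + 2..p + q + 1} = 2 * e + (real q - 3) * f + g"
    unfolding sum_right_pendants[OF pq(2)] y using yf pq(2) by (simp add: of_nat_diff)
  have h: "(real p - 1) * b + c = m * a + s" "a = m * b + s" "a + g = m * c + s"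
    "2 * e + (real q - 3) * f + g = m * d + s" "d + e = m * e + s" "d = m * f + s" "d + c = m * g + s"
    "s = a + (real p - 1) * b + c + d + 2 * e + (real q - 3) * f + g"
    using eqs unfolding class_eqs_def by blast+
  have s: "vsum (p + q + 2) y = s"
    unfolding vsum_def sum_all_vertices sl sr y using h(8) by linarith
  note nb = nbr_sum_U_edge[OF pq]
  have ev: "eigvec (p + q + 2) (U_edge p q) m y"
    unfolding eigvec_def s
  proof (intro allI impI)
    fix i assume i: "i < p + q + 2"
    consider "i = 0" | "i = Suc 0" | "i \<in> {2..p}" | "i = p + 1" | "i = p + 2" | "i = p + 3"
      | "i \<in> {p + 4..p + q}" | "i = p + q + 1" using i by fastforce
    then show "nbr_sum (p + q + 2) (U_edge p q) y i = m * y i + s"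
    proof cases
      case 1 show ?thesis unfolding 1 nb(1) sl y using h(1) by linarith
    next
      case 2 show ?thesis unfolding 2 nb(3) y y(2)[unfolded One_nat_def] using h(3) by linarith
    next
      case 3 show ?thesis unfolding nb(2)[OF 3] yb[OF 3] y using h(2) by linarith
    next
      case 4 show ?thesis unfolding 4 nb(4) sr y using h(4) by linarith
    next
      case 5 show ?thesis unfolding 5 nb(5) y using h(5) by linarith
    next
      case 6 show ?thesis unfolding 6 nb(6) y using h(5) by linarith
    next
      case 7 show ?thesis unfolding nb(7)[OF 7] yf[OF 7] y using h(6) by linarith
    next
      case 8 show ?thesis unfolding 8 nb(8) y using h(7) by linarith
    qed
  qed
  \<comment> \<open>If \<open>y\<close> vanished, so would \<open>s\<close> and \<open>a\<close>,
    and \<open>a = m * b + s\<close> gives \<open>b = 0\<close> even when \<open>b\<close> is no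
    entry of \<open>y\<close>.\<close>
  have "\<exists>i<p + q + 2. y i \<noteq> 0"
  proof (rule ccontr)
    assume "\<not> ?thesis"
    then have z: "y i = 0" if "i < p + q + 2" for i using that by blast
    have "s = 0" unfolding s[symmetric] vsum_def by (rule sum.neutral) (use z in simp)
    moreover have "a = 0" using z[of 0] y by simp
    ultimately have "m * b = 0" using h(2) by simp
    then show False using m nz \<open>s = 0\<close> by simp
  qed
  then show ?thesis using ev by blast
qed

text \<open>The determinant of \<open>B - m I\<close>, where \<open>B\<close> is the 7 by 7 quotient
  matrix of \<open>A - J\<close> on the classes \<open>a\<close> to \<open>g\<close>, sorted by
  monomials in \<open>p\<close> and \<open>q\<close>.\<close>

definition char_U :: "real \<Rightarrow> real \<Rightarrow> real \<Rightarrow> real" where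
  "char_U p q m = (- (m^7) - m^6 - m^5 - 5*m^4 + 4*m^3 + 6*m^2 - m + 9) + q
      * (- (m^6) + 3*m^4 - m^3 + 2*m - 3) + p * (- (m^6) + 3*m^4 + 3*m^3 + 6*m^2 - 2*m - 9)
    + p * q * (2*m^4 + m^3 - 5*m^2 - m + 3)"

text \<open>Expressing \<open>a, c, g, d\<close> (and, after multiplication by \<open>m (m - 1)\<close>, also \<open>e, f\<close>) through
  \<open>b\<close> and \<open>s\<close> leaves two linear equations in \<open>b, s\<close>; their determinant is \<open>m (m - 1)\<close> times
  \<open>char_U p q m\<close>.\<close>
definition row1_b :: "real \<Rightarrow> real \<Rightarrow> real \<Rightarrow> real" where
  "row1_b p q m = (m^7 - m^6 - m^5 - m^4 - 2*m^3 + 4*m^2 - m + 3) + q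
      * (- (m^5) + m^4 + m^3 - m^2 + m - 1)
    + p * (- (m^5) + m^4 + m^3 + m^2 + m - 3) + p * q * (m^3 - m^2 - m + 1)"
definition row1_s :: "real \<Rightarrow> real \<Rightarrow> real" where
  "row1_s q m = (m^6 - 2*m^4 - m^3 - 2*m^2 + m + 3) + q * (- (m^4) + 2*m^2 - 1)"
definition row2_b :: "real \<Rightarrow> real \<Rightarrow> real \<Rightarrow> real" where
  "row2_b p q m = (m^6 - m^5 + 2*m^4 + 2*m^3 - 5*m^2 + 2*m - 3) + q * (m^5 - m^4 - m^3 + m^2 - m + 1)
    + p * (- (m^4) + m^3 - m^2 - 2*m + 3) + p * q * (- (m^3) + m^2 + m - 1)"
definition row2_s :: "real \<Rightarrow> real \<Rightarrow> real" where
  "row2_s q m = (m^5 + m^3 + 4*m^2 - 3*m - 3) + q * (m^4 - 2*m^2 + 1)"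

text \<open>The entries for \<open>s\<close> are free of \<open>p\<close>, so the determinant is
  affine in \<open>p\<close>. \<open>expand\<close> sorts it by monomials in \<open>p\<close> and
  \<open>q\<close>; \<open>k2\<close> and \<open>k5\<close> cancel the terms with
  \<open>q * q\<close>.\<close>

lemma det_char_U: "row1_b p q m * row2_s q m - row1_s q m * row2_b p q m = m * (m - 1) * char_U p q m"
proof -
  have expand: "(a0 + q * a1 + p * a2 + p * q * a3) * (d0 + q * d1) - (b0 + q * b1) * (c0 + q * c1 + p * c2 + p * q * c3)
    = (a0 * d0 - b0 * c0) + q * (a0 * d1 + a1 * d0 - b0 * c1 - b1 * c0) + q * q * (a1 * d1 - b1 * c1)
      + p * (a2 * d0 - b0 * c2) + p * q * (a2 * d1 + a3 * d0 - b0 * c3 - b1 * c2)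
      + p * q * q * (a3 * d1 - b1 * c3)" for a0 a1 a2 a3 b0 b1 c0 c1 c2 c3 d0 d1 :: real
    by (simp add: algebra_simps)
  have k0: "(m^7 - m^6 - m^5 - m^4 - 2*m^3 + 4*m^2 - m + 3) * (m^5 + m^3 + 4*m^2 - 3*m - 3)
      - (m^6 - 2*m^4 - m^3 - 2*m^2 + m + 3) * (m^6 - m^5 + 2*m^4 + 2*m^3 - 5*m^2 + 2*m - 3)
    = m * (m - 1) * (- (m^7) - m^6 - m^5 - 5*m^4 + 4*m^3 + 6*m^2 - m + 9)"
    by (simp add: algebra_simps power_numeral_reduce)
  have k1: "(m^7 - m^6 - m^5 - m^4 - 2*m^3 + 4*m^2 - m + 3) * (m^4 - 2*m^2 + 1)
      + (- (m^5) + m^4 + m^3 - m^2 + m - 1) * (m^5 + m^3 + 4*m^2 - 3*m - 3)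
      - (m^6 - 2*m^4 - m^3 - 2*m^2 + m + 3) * (m^5 - m^4 - m^3 + m^2 - m + 1) - (- (m^4) + 2*m^2 - 1)
      * (m^6 - m^5 + 2*m^4 + 2*m^3 - 5*m^2 + 2*m - 3)
    = m * (m - 1) * (- (m^6) + 3*m^4 - m^3 + 2*m - 3)"
    by (simp add: algebra_simps power_numeral_reduce)
  have k2: "(- (m^5) + m^4 + m^3 - m^2 + m - 1) * (m^4 - 2*m^2 + 1) - (- (m^4) + 2*m^2 - 1)
      * (m^5 - m^4 - m^3 + m^2 - m + 1)
    = 0"
    by (simp add: algebra_simps power_numeral_reduce)
  have k3: "(- (m^5) + m^4 + m^3 + m^2 + m - 3) * (m^5 + m^3 + 4*m^2 - 3*m - 3)
      - (m^6 - 2*m^4 - m^3 - 2*m^2 + m + 3) * (- (m^4) + m^3 - m^2 - 2*m + 3)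
    = m * (m - 1) * (- (m^6) + 3*m^4 + 3*m^3 + 6*m^2 - 2*m - 9)"
    by (simp add: algebra_simps power_numeral_reduce)
  have k4: "(- (m^5) + m^4 + m^3 + m^2 + m - 3) * (m^4 - 2*m^2 + 1) + (m^3 - m^2 - m + 1)
      * (m^5 + m^3 + 4*m^2 - 3*m - 3) - (m^6 - 2*m^4 - m^3 - 2*m^2 + m + 3) * (- (m^3) + m^2 + m - 1)
      - (- (m^4) + 2*m^2 - 1) * (- (m^4) + m^3 - m^2 - 2*m + 3)
    = m * (m - 1) * (2*m^4 + m^3 - 5*m^2 - m + 3)"
    by (simp add: algebra_simps power_numeral_reduce)
  have k5: "(m^3 - m^2 - m + 1) * (m^4 - 2*m^2 + 1) - (- (m^4) + 2*m^2 - 1) * (- (m^3) + m^2 + m - 1)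
    = 0"
    by (simp add: algebra_simps power_numeral_reduce)
  show ?thesis
    unfolding row1_b_def row2_b_def row1_s_def row2_s_def char_U_def expand k0 k1 k2 k3 k4 k5
    by (simp add: algebra_simps)
qed

lemma class_eqs_linear:
  assumes m: "m > 1" and a: "a = m * b + s" and c: "c = m * a + s - (p - 1) * b"
    and g: "g = m * c + s - a" and d: "d = m * g + s - c"
    and e: "d + e = m * e + s" and f: "d = m * f + s"
  shows "row1_b p q m * b + row1_s q m * s = m * (m - 1) * (m * d + s - (2 * e + (q - 3) * f + g))"
    "row2_b p q m * b + row2_s q m * s = m * (m - 1) * (a + (p - 1) * b + c + d + 2 * e
      + (q - 3) * f + g - s)"
proof -
  have e': "(m - 1) * e = d - s" and f': "m * f = d - s" using e f by (simp_all add: algebra_simps)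
  have "m * (m - 1) * (2 * e + (q - 3) * f) = 2 * m * ((m - 1) * e) + (q - 3) * (m - 1) * (m * f)"
    by (simp add: algebra_simps)
  then have ef: "m * (m - 1) * (2 * e + (q - 3) * f) = (2 * m + (q - 3) * (m - 1)) * (d - s)"
    unfolding e' f' by (simp add: algebra_simps)
  have "m * (m - 1) * (m * d + s - (2 * e + (q - 3) * f + g))
    = m * (m - 1) * (m * d + s - g) - m * (m - 1) * (2 * e + (q - 3) * f)"
    by (simp add: algebra_simps)
  also have "\<dots> = row1_b p q m * b + row1_s q m * s"
    unfolding ef d g c a row1_b_def row1_s_def by (simp add: algebra_simps power_numeral_reduce)
  finally show "row1_b p q m * b + row1_s q m * s = m * (m - 1) * (m * d + s - (2 * e + (q - 3) * f + g))" ..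
  have "m * (m - 1) * (a + (p - 1) * b + c + d + 2 * e + (q - 3) * f + g - s)
    = m * (m - 1) * (a + (p - 1) * b + c + d + g - s) + m * (m - 1) * (2 * e + (q - 3) * f)"
    by (simp add: algebra_simps)
  also have "\<dots> = row2_b p q m * b + row2_s q m * s"
    unfolding ef d g c a row2_b_def row2_s_def by (simp add: algebra_simps power_numeral_reduce)
  finally show "row2_b p q m * b + row2_s q m * s
    = m * (m - 1) * (a + (p - 1) * b + c + d + 2 * e + (q - 3) * f + g - s)" ..
qed

lemma char_U_zero_if_class_eqs:
  assumes m: "m > 1" and eqs: "class_eqs p q m a b c d e f g s" and nz: "b \<noteq> 0 \<or> s \<noteq> 0"
  shows "char_U p q m = 0"
proof -
  have h: "a = m * b + s" "c = m * a + s - (p - 1) * b" "g = m * c + s - a" "d = m * g + s - c"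
     "d + e = m * e + s" "d = m * f + s" "m * d + s - (2 * e + (q - 3) * f + g) = 0"
     "a + (p - 1) * b + c + d + 2 * e + (q - 3) * f + g - s = 0"
    using eqs unfolding class_eqs_def by linarith+
  have L: "row1_b p q m * b + row1_s q m * s = 0" "row2_b p q m * b + row2_s q m * s = 0"
    using class_eqs_linear[OF m h(1-6)] h(7,8) by simp_all
  have "(row1_b p q m * row2_s q m - row1_s q m * row2_b p q m) * b
      = row2_s q m * (row1_b p q m * b + row1_s q m * s) - row1_s q m * (row2_b p q m * b + row2_s q m * s)"
    "(row1_b p q m * row2_s q m - row1_s q m * row2_b p q m) * s
      = row1_b p q m * (row2_b p q m * b + row2_s q m * s) - row2_b p q m * (row1_b p q m * b + row1_s q m * s)"
    by (simp_all add: algebra_simps)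
  then have "row1_b p q m * row2_s q m - row1_s q m * row2_b p q m = 0" using L nz by auto
  then show ?thesis using m by (simp add: det_char_U)
qed

lemma class_eqs_if_char_U_zero:
  assumes m: "m > 1" and D: "char_U p q m = 0"
  shows "\<exists>a b c d e f g s. class_eqs p q m a b c d e f g s \<and> (b \<noteq> 0 \<or> s \<noteq> 0)"
proof -
  have det: "row1_b p q m * row2_s q m = row1_s q m * row2_b p q m" using det_char_U[of p q m] D by simp
  obtain b s where bs: "b \<noteq> 0 \<or> s \<noteq> 0" "row1_b p q m * b + row1_s q m * s = 0" "row2_b p q m * b + row2_s q m * s = 0"
  proof (cases "row1_b p q m \<noteq> 0 \<or> row1_s q m \<noteq> 0")
    case True
    then show ?thesis using det by (intro that[of "- row1_s q m" "row1_b p q m"]) (auto simp: algebra_simps)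
  next
    case F: False
    show ?thesis
    proof (cases "row2_b p q m \<noteq> 0 \<or> row2_s q m \<noteq> 0")
      case True
      then show ?thesis using F by (intro that[of "- row2_s q m" "row2_b p q m"]) (auto simp: algebra_simps)
    next
      case False
      then show ?thesis using F by (intro that[of 1 0]) auto
    qed
  qed
  define a where "a = m * b + s"
  define c where "c = m * a + s - (p - 1) * b"
  define g where "g = m * c + s - a"
  define d where "d = m * g + s - c"
  define e where "e = (d - s) / (m - 1)"
  define f where "f = (d - s) / m"
  have e: "d + e = m * e + s" and f: "d = m * f + s" using m by (simp_all add: e_def f_def field_simps)
  have "m * (m - 1) \<noteq> 0" using m by simp
  then have "m * d + s - (2 * e + (q - 3) * f + g) = 0"
    "a + (p - 1) * b + c + d + 2 * e + (q - 3) * f + g - s = 0"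
    using class_eqs_linear[OF m a_def c_def g_def d_def e f, of q] bs by simp_all
  then have "class_eqs p q m a b c d e f g s"
    unfolding class_eqs_def using e f a_def c_def g_def d_def by linarith
  then show ?thesis using bs(1) by blast
qed

section \<open>Balanced parameters are optimal\<close>

lemma power_step:
  fixes m :: real
  assumes "m \<ge> c" "c > 0"
  shows "c * m ^ k \<le> m ^ Suc k"
  using assms by (simp add: mult_right_mono)

text \<open>From 10 on each power exceeds the next lower one tenfold. The term with
  \<open>p * q\<close> is at most \<open>3 * M^6\<close>, which \<open>- (M^7)\<close>
  absorbs.\<close>

lemma char_U_le_0:
  assumes p: "p \<ge> 0" and q: "q \<ge> 0" and M: "M \<ge> 10" "M \<ge> p" "M \<ge> q"
  shows "char_U p q M \<le> 0"
proof -
  have s: "10 * M \<le> M^2" "10 * M^2 \<le> M^3" "10 * M^3 \<le> M^4" "10 * M^4 \<le> M^5" "10 * M^5 \<le> M^6" "10 * M^6 \<le> M^7"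
    using power_step[OF M(1), of 1] power_step[OF M(1), of 2] power_step[OF M(1), of 3]
      power_step[OF M(1), of 4] power_step[OF M(1), of 5] power_step[OF M(1), of 6]
    by (simp_all add: numeral_eq_Suc)
  have 1: "q * (- (M^6) + 3*M^4 - M^3 + 2*M - 3) \<le> 0"
    using q s M by (intro mult_nonneg_nonpos) linarith+
  have 2: "p * (- (M^6) + 3*M^4 + 3*M^3 + 6*M^2 - 2*M - 9) \<le> 0"
    using p s M by (intro mult_nonneg_nonpos) linarith+
  have "p * q * (2*M^4 + M^3 - 5*M^2 - M + 3) \<le> (M * M) * (3 * M^4)"
    using p q s M by (intro mult_mono) (linarith | simp)+
  also have "\<dots> = 3 * M^6" by (simp add: power_numeral_reduce)
  finally have 3: "p * q * (2*M^4 + M^3 - 5*M^2 - M + 3) \<le> 3 * M^6" .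
  show ?thesis unfolding char_U_def using 1 2 3 s M by linarith
qed

text \<open>The polynomial is positive at \<open>m\<close> and non-positive far out, so it has a
  root beyond \<open>m\<close>; roots above 1 are eigenvalues of \<open>A - J\<close>.\<close>

lemma colambda_gt_if_char_U_pos:
  assumes pq: "p \<ge> 1" "q \<ge> 3" and m: "m > 1" and pos: "char_U p q m > 0"
  shows "m < colambda (p + q + 2) (U_edge p q)"
proof -
  define M where "M = m + real p + real q + 10"
  have "char_U p q M \<le> 0" using m by (intro char_U_le_0) (auto simp: M_def)
  moreover have "continuous_on {m..M} (char_U p q)"
    unfolding char_U_def by (intro continuous_intros)
  ultimately obtain z where z: "m \<le> z" "z \<le> M" "char_U p q z = 0"
    using IVT2'[of "char_U p q" M 0 m] pos m by (force simp: M_def)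
  have "m < z" using z pos by (cases "m = z") auto
  have z1: "z > 1" using \<open>m < z\<close> m by simp
  obtain a b c d e f g s where eqs: "class_eqs p q z a b c d e f g s" and nz: "b \<noteq> 0 \<or> s \<noteq> 0"
    using class_eqs_if_char_U_zero[OF z1 z(3)] by blast
  obtain y where "eigvec (p + q + 2) (U_edge p q) z y" "\<exists>i<p + q + 2. y i \<noteq> 0"
    using eigvec_if_class_eqs[OF pq z1 eqs nz] by blast
  then have "z \<le> colambda (p + q + 2) (U_edge p q)"
    using colambda_ge[OF simple_graph_U_edge[OF pq]] by blast
  then show ?thesis using \<open>m < z\<close> by simp
qed

lemma colambda_balanced_gt_3:
  assumes "p \<ge> 9" "q \<ge> 9"
  shows "3 < colambda (p + q + 2) (U_edge p q)"
proof (rule colambda_gt_if_char_U_pos)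
  \<comment> \<open>The bound 9 matters: \<open>char_U p q 3\<close> is 384 at \<open>(9,9)\<close>
    but -402 at \<open>(9,8)\<close>, the balanced pair for \<open>n = 19\<close>.\<close>
  have "0 \<le> (real p - 9) * (real q - 9)" using assms by (intro mult_nonneg_nonneg) auto
  then have "9 * real p + 9 * real q - 81 \<le> real p * real q" by (simp add: algebra_simps)
  then have "144 * (9 * real p + 9 * real q - 81) \<le> 144 * (real p * real q)" by simp
  moreover have "char_U p q 3 = - 3396 + real q * (- 510) + real p * (- 366) + real p * real q * 144"
    by (simp add: char_U_def)
  ultimately show "0 < char_U p q 3" using assms by (simp add: algebra_simps)
qed (use assms in auto)

definition balanced :: "nat \<Rightarrow> nat \<Rightarrow> bool" where
  "balanced p q \<longleftrightarrow> p = q \<or> p = q + 1"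

text \<open>For a fixed sum \<open>p + q\<close> the difference of the two polynomials is
  \<open>t * (B + C * t)\<close> or, for odd sum, \<open>t * (B + C * (t - 1))\<close>. Since
  \<open>0 < B < C\<close>, both are positive for every integer \<open>t \<noteq> 0\<close>. For odd
  sum \<open>t = 1\<close> is the swapped pair, with difference \<open>B > 0\<close>: the triangle
  belongs on the smaller side.\<close>

lemma char_U_balanced_pos:
  assumes bal: "balanced p' q'" and sum: "p + q = p' + q'" and ne: "q \<noteq> q'"
    and m: "m > 3" and zero: "char_U p q m = 0"
  shows "char_U p' q' m > 0"
proof -
  \<comment> \<open>\<open>B\<close>: coefficient of \<open>p\<close> minus coefficient of \<open>q\<close> in \<open>char_U\<close>; \<open>C\<close>: coefficient of \<open>p q\<close>\<close>
  define B where "B = 4*m^3 + 6*m^2 - 4*m - 6"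
  define C where "C = 2*m^4 + m^3 - 5*m^2 - m + 3"
  define t where "t = int q - int q'"
  have t: "real q = real q' + t" "real p = real p' - t" using sum by (auto simp: t_def)
  have s: "3 * m \<le> m^2" "3 * m^2 \<le> m^3"
    using power_step[of 3 m 1] power_step[of 3 m 2] m by (simp_all add: numeral_eq_Suc)
  have B: "B > 0" unfolding B_def using s m by linarith
  \<comment> \<open>This is where \<open>m > 3\<close> enters: \<open>C - B\<close> has the root
    3.\<close>
  have "C - B = (m - 3) * (2*m^3 + 3*m^2 - 2*m - 3)"
    unfolding C_def B_def by (simp add: algebra_simps power_numeral_reduce)
  moreover have "(m - 3) * (2*m^3 + 3*m^2 - 2*m - 3) > 0"
    using s m by (intro mult_pos_pos) linarith+
  ultimately have C: "C > B" by linarith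
  have diff: "char_U p' q' m - char_U p q m = B * t + C * (real p' * real q' - real p * real q)"
    unfolding t char_U_def B_def C_def by (simp add: algebra_simps)
  have tcase: "t \<ge> 1 \<or> t \<le> -1" using ne by (auto simp: t_def)
  have "B * t + C * (real p' * real q' - real p * real q) > 0"
  proof (cases "p' = q'")
    case True
    then have e: "B * t + C * (real p' * real q' - real p * real q) = t * (B + C * t)"
      unfolding t by (simp add: algebra_simps)
    show ?thesis
    proof (cases "t \<ge> 1")
      case True
      then show ?thesis unfolding e using B C by (intro mult_pos_pos add_pos_pos) auto
    next
      case False
      then have "t \<le> -1" using tcase by simp
      then have "C * t \<le> C * (-1)" using B C by (intro mult_left_mono) auto
      then have "B + C * t < 0" using C by simp
      then show ?thesis unfolding e using \<open>t \<le> -1\<close> by (intro mult_neg_neg) auto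
    qed
  next
    case False
    then have "p' = q' + 1" using bal by (simp add: balanced_def)
    then have e: "B * t + C * (real p' * real q' - real p * real q) = t * (B + C * (t - 1))"
      unfolding t by (simp add: algebra_simps)
    show ?thesis
    proof (cases "t \<ge> 1")
      case True
      then have "B + C * (t - 1) > 0" using B C by (intro add_pos_nonneg mult_nonneg_nonneg) auto
      then show ?thesis unfolding e using True by (intro mult_pos_pos) auto
    next
      case False
      then have t1: "t \<le> -1" using tcase by simp
      then have "C * (t - 1) \<le> C * (-2)" using B C by (intro mult_left_mono) auto
      then have "B + C * (t - 1) < 0" using B C by simp
      then show ?thesis unfolding e using t1 by (intro mult_neg_neg) auto
    qed
  qed
  then show ?thesis using diff zero by simp
qed

text \<open>Arguing by contradiction puts the eigenvalue of the unbalanced pair above 3, where the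
  balanced polynomial is known to be positive.\<close>

lemma colambda_lt_balanced:
  assumes bal: "balanced p' q'" "q' \<ge> 9" and sum: "p + q = p' + q'" and ne: "q \<noteq> q'"
    and pq: "p \<ge> 1" "q \<ge> 3"
  shows "colambda (p + q + 2) (U_edge p q) < colambda (p' + q' + 2) (U_edge p' q')"
proof (rule ccontr)
  let ?\<mu> = "colambda (p + q + 2) (U_edge p q)"
  assume "\<not> ?thesis"
  then have ge: "colambda (p' + q' + 2) (U_edge p' q') \<le> ?\<mu>" by simp
  have p': "p' \<ge> 9" using bal by (auto simp: balanced_def)
  then have \<mu>: "?\<mu> > 3" using colambda_balanced_gt_3[OF p' bal(2)] ge by linarith
  obtain y where y: "eigvec (p + q + 2) (U_edge p q) ?\<mu> y" "\<exists>i<p + q + 2. y i \<noteq> 0"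
    using colambda_eigvec[OF _ simple_graph_U_edge[OF pq]] by auto
  have \<mu>1: "?\<mu> > 1" using \<mu> by simp
  obtain b f where "class_eqs p q ?\<mu> (y 0) b (y 1) (y (p + 1)) (y (p + 2)) f (y (p + q + 1)) (vsum (p + q + 2) y)"
    "b \<noteq> 0 \<or> vsum (p + q + 2) y \<noteq> 0"
    using class_eqs_if_eigvec[OF pq \<mu>1 y] by blast
  then have "char_U p q ?\<mu> = 0" using char_U_zero_if_class_eqs[OF \<mu>1] by blast
  then have "char_U p' q' ?\<mu> > 0" by (rule char_U_balanced_pos[OF bal(1) sum ne \<mu>])
  then have "?\<mu> < colambda (p' + q' + 2) (U_edge p' q')"
    using p' bal(2) by (intro colambda_gt_if_char_U_pos[OF _ _ \<mu>1]) simp_all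
  then show False using ge by simp
qed

text \<open>Only \<open>0 < c\<close> and \<open>g < 0\<close> need estimates; the other strict
  inequalities then follow from the equations. The two centre equations exclude \<open>c = 0\<close>
  by \<open>p \<le> q + 1\<close>, and \<open>g = 0\<close> by \<open>q \<le> p\<close>.\<close>

lemma class_eqs_strict:
  fixes p q m a b c d e f g s :: real
  assumes eqs: "class_eqs p q m a b c d e f g s" and nz: "b \<noteq> 0 \<or> s \<noteq> 0"
    and m: "m > 3" and pq: "p \<ge> 3" "q \<ge> 3" "q \<le> p" "p \<le> q + 1"
    and P: "a \<ge> 0" "b \<ge> 0" "c \<ge> 0" "b \<le> a" and N: "d \<le> 0" "e \<le> 0" "f \<le> 0" "g \<le> 0" "d \<le> e"
  shows "0 < c" "c < b" "b < a" "d < e" "e < f" "f < g" "g < 0"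
proof -
  have h: "(p - 1) * b + c = m * a + s" "a = m * b + s" "a + g = m * c + s"
    "2 * e + (q - 3) * f + g = m * d + s" "d + e = m * e + s" "d = m * f + s" "d + c = m * g + s"
    "s = a + (p - 1) * b + c + d + 2 * e + (q - 3) * f + g"
    using eqs unfolding class_eqs_def by blast+
  \<comment> \<open>The sum of the two centre equations, with \<open>s\<close> as the sum of all
    entries.\<close>
  have sm: "(m + 1) * (a + d) + s = 0"
    using h(1,4,8) by (simp add: algebra_simps)
  have mc: "m * c = m * b + g" using h(2,3) by linarith
  have mg: "m * g = m * f + c" using h(6,7) by linarith
  have me: "(m - 1) * e = m * f" using h(5,6) by (simp add: algebra_simps)
  have s3: "3 * m \<le> m^2" "3 * m^2 \<le> m^3"
    using power_step[of 3 m 1] power_step[of 3 m 2] m by (simp_all add: numeral_eq_Suc)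
  show c: "0 < c"
  proof (rule ccontr)
    assume "\<not> ?thesis"
    then have c0: "c = 0" using P by simp
    have g: "g = - (m * b)" using mc c0 by simp
    have "f = g" using mg c0 m by simp
    then have f: "f = - (m * b)" using g by simp
    have d: "d = s - m * m * b" using h(6) f by simp
    have "(2 * m + 3) * s = (m^3 - m) * b"
      using sm unfolding h(2) d by (simp add: algebra_simps power_numeral_reduce)
    have b: "b > 0"
    proof (rule ccontr)
      assume "\<not> ?thesis"
      then have "b = 0" using P by simp
      then show False using \<open>(2 * m + 3) * s = _\<close> nz m by simp
    qed
    \<comment> \<open>This yields \<open>2 * b \<le> s\<close>, whereas the centre equations give
      \<open>(m + 1) * (m + 1) * s \<le> 2 * m * b\<close>.\<close>
    have "2 * (2 * m + 3) \<le> m^3 - m" using s3 m by simp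
    then have "2 * (2 * m + 3) * b \<le> (m^3 - m) * b" using b by (intro mult_right_mono) simp_all
    moreover have "2 * (2 * m + 3) * b = (2 * m + 3) * (2 * b)" by (simp only: mult_ac)
    ultimately have "(2 * m + 3) * (2 * b) \<le> (2 * m + 3) * s" using \<open>(2 * m + 3) * s = _\<close> by linarith
    then have s: "2 * b \<le> s" using m by simp
    have "(p - 1) * b = m * m * b + (m + 1) * s" using h(1) c0 unfolding h(2) by (simp add: algebra_simps)
    then have 1: "m * ((p - 1) * b) = m * m * m * b + m * (m + 1) * s" by (simp add: algebra_simps)
    have "2 * e - (q - 2) * (m * b) = m * d + s" using h(4) unfolding f g by (simp add: algebra_simps)
    then have 2: "(q - 2) * (m * b) \<le> m * m * m * b - (m + 1) * s" using N unfolding d by (simp add: algebra_simps)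
    have "m * ((p - 1) * b) \<le> m * (q * b)" using m b pq by (intro mult_left_mono mult_right_mono) auto
    then have "(m + 1) * (m + 1) * s \<le> 2 * m * b" using 1 2 by (simp add: algebra_simps)
    moreover have "(m + 1) * (m + 1) * (2 * b) \<le> (m + 1) * (m + 1) * s" using s m by (intro mult_left_mono) auto
    moreover have "2 * m * b < (m + 1) * (m + 1) * (2 * b)"
    proof -
      have "0 < m * m * b" "0 < m * b" using b m by simp_all
      then show ?thesis using b by (simp add: algebra_simps)
    qed
    ultimately show False by linarith
  qed
  have b0: "0 < b"
  proof (rule ccontr)
    assume "\<not> 0 < b"
    then have "b = 0" using P by simp
    then have "m * c \<le> 0" using mc N by simp
    then show False using c m by (simp add: mult_le_0_iff)
  qed
  show g: "g < 0"
  proof (rule ccontr)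
    assume "\<not> ?thesis"
    then have g0: "g = 0" using N by simp
    have cb: "c = b" using mc g0 m by simp
    have mf: "m * f = - b" using mg g0 cb by simp
    have d: "d = s - b" using h(6) mf by simp
    have s: "(2 * m + 3) * s = - ((m^2 - 1) * b)"
      using sm unfolding h(2) d by (simp add: algebra_simps power_numeral_reduce)
    have "(2 * m + 3) * s < 0" unfolding s using b0 s3 m by (simp add: mult_pos_pos)
    then have sneg: "s < 0" using m by (simp add: mult_less_0_iff)
    have 1: "p * b = m * m * b + (m + 1) * s" using h(1) cb unfolding h(2) by (simp add: algebra_simps)
    have "m * (2 * e) + (q - 3) * (m * f) = m * (2 * e + (q - 3) * f)" by (simp add: algebra_simps)
    also have "2 * e + (q - 3) * f = m * d + s" using h(4) g0 by linarith
    finally have "m * (2 * e) + (q - 3) * (m * f) = m * (m * d + s)" .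
    then have 2: "(q - 3) * b = m * (2 * e) + m * m * b - m * (m + 1) * s"
      unfolding mf d by (simp add: algebra_simps)
    \<comment> \<open>Aims at \<open>2 * m * e > - 3 * b\<close>, after which the centre equations
      place \<open>m * m * b\<close> strictly between \<open>p * b\<close> and
      \<open>q * b\<close>.\<close>
    have "(m - 1) * (m * (2 * e)) = 2 * m * ((m - 1) * e)" by (simp only: mult_ac)
    also have "\<dots> = - (2 * m * b)" unfolding me mf by simp
    finally have "(m - 1) * (m * (2 * e)) = - (2 * m * b)" .
    moreover have "(m - 1) * (3 * b) - 2 * m * b = (m - 3) * b" by (simp add: algebra_simps)
    moreover have "(m - 3) * b > 0" using m b0 by simp
    ultimately have "(m - 1) * (m * (2 * e) + 3 * b) > 0" by (simp add: algebra_simps)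
    then have e: "m * (2 * e) + 3 * b > 0" using m by (simp add: zero_less_mult_iff)
    have "(m + 1) * s < 0" "m * (m + 1) * s < 0" using sneg m by (simp_all add: mult_pos_neg)
    then have "p * b < q * b" using 1 2 e by (simp add: algebra_simps)
    then show False using b0 pq by simp
  qed
  show "c < b" using mc g m by (metis add_less_same_cancel1 add.commute mult_less_cancel_left_pos less_trans zero_less_numeral)
  have "m * f < m * g" using mg c by simp
  then show fg: "f < g" using m by simp
  then have f0: "f < 0" using g by simp
  have "(m - 1) * e < (m - 1) * f" using me f0 by (simp add: algebra_simps)
  then show "e < f" using m by simp
  show "b < a"
  proof (rule ccontr)
    assume "\<not> ?thesis"
    then have ab: "a = b" using P by simp
    have "(p - 1) * b + c = b" using h(1,2) unfolding ab by linarith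
    then have "(p - 2) * b + c = 0" by (simp add: algebra_simps)
    moreover have "(p - 2) * b > 0" using pq b0 by simp
    ultimately show False using c by simp
  qed
  show "d < e"
  proof (rule ccontr)
    assume "\<not> ?thesis"
    then have de: "d = e" using N by simp
    have "(q - 3) * f + g = 0" using h(4,5) de by (simp add: algebra_simps)
    moreover have "(q - 3) * f \<le> 0" using pq f0 by (simp add: mult_nonneg_nonpos)
    ultimately show False using g by simp
  qed
qed

section \<open>Relabelling a unicyclic graph\<close>

text \<open>The one equality reflects the symmetry of the triangle vertices; the strict inequalities
  make centres and joining vertices the unique extremal entries of their parts.\<close>

definition strict_profile :: "nat \<Rightarrow> nat \<Rightarrow> (nat \<Rightarrow> real) \<Rightarrow> bool" where
  "strict_profile p q y \<longleftrightarrow> 0 < y 1 \<and> y 1 < y 0 \<and> (\<forall>k\<in>{2..p}. y 1 < y k \<and> y k < y 0) \<and>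
    y (p + 1) < y (p + 2) \<and> y (p + 3) = y (p + 2) \<and> y (p + 2) < y (p + q + 1) \<and>
    (\<forall>k\<in>{p + 4..p + q}. y (p + 2) < y k \<and> y k < y (p + q + 1)) \<and> y (p + q + 1) < 0"

lemma eigvec_strict_profile:
  assumes pq: "p \<ge> 9" "q \<ge> 9" "balanced p q" and m: "m > 3"
    and ev: "eigvec (p + q + 2) (U_edge p q) m y" and nz: "\<exists>i<p + q + 2. y i \<noteq> 0"
    and P: "\<And>i. i \<le> p \<Longrightarrow> 0 \<le> y i" "\<And>i. i \<le> p \<Longrightarrow> y i \<le> y 0"
    and N: "\<And>i. i \<in> {p + 1..p + q + 1} \<Longrightarrow> y i \<le> 0" "\<And>i. i \<in> {p + 1..p + q + 1} \<Longrightarrow> y (p + 1) \<le> y i"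
  shows "strict_profile p q y"
proof -
  have pq': "p \<ge> 1" "q \<ge> 3" and m1: "m > 1" using pq m by auto
  obtain b f where bf: "class_eqs p q m (y 0) b (y 1) (y (p + 1)) (y (p + 2)) f (y (p + q + 1)) (vsum (p + q + 2) y) \<and>
    (\<forall>k\<in>{2..p}. y k = b) \<and> y (p + 3) = y (p + 2) \<and> (\<forall>k\<in>{p + 4..p + q}. y k = f) \<and>
    (b \<noteq> 0 \<or> vsum (p + q + 2) y \<noteq> 0)"
    using class_eqs_if_eigvec[OF pq' m1 ev nz] by (elim exE)
  then have eqs: "class_eqs p q m (y 0) b (y 1) (y (p + 1)) (y (p + 2)) f (y (p + q + 1)) (vsum (p + q + 2) y)"
    and b: "\<And>k. k \<in> {2..p} \<Longrightarrow> y k = b" and e: "y (p + 3) = y (p + 2)"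
    and f: "\<And>k. k \<in> {p + 4..p + q} \<Longrightarrow> y k = f"
    and bs: "b \<noteq> 0 \<or> vsum (p + q + 2) y \<noteq> 0"
    by blast+
  \<comment> \<open>Both pendant classes are non-empty here, so the sign conditions reach
    \<open>b\<close> and \<open>f\<close>.\<close>
  have b2: "y 2 = b" and f4: "y (p + 4) = f" using b[of 2] f[of "p + 4"] pq by auto
  have r: "real p \<ge> 3" "real q \<ge> 3" "real q \<le> real p" "real p \<le> real q + 1"
    using pq by (auto simp: balanced_def)
  have s1: "y 0 \<ge> 0" "b \<ge> 0" "y 1 \<ge> 0" "b \<le> y 0" using P(1)[of 0] P(1)[of 2] P(1)[of 1] P(2)[of 2] b2 pq by auto
  have s2: "y (p + 1) \<le> 0" "y (p + 2) \<le> 0" "f \<le> 0" "y (p + q + 1) \<le> 0" "y (p + 1) \<le> y (p + 2)"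
    using N(1)[of "p + 1"] N(1)[of "p + 2"] N(1)[of "p + 4"] N(1)[of "p + q + 1"] N(2)[of "p + 2"] f4 pq by auto
  note st = class_eqs_strict[OF eqs bs m r s1 s2]
  show ?thesis unfolding strict_profile_def using st e b f by auto
qed

text \<open>Without a sign change the form is largest on the complete graph, where
  \<open>A - J = - I\<close>.\<close>

lemma quad_same_sign:
  assumes G: "simple_graph n E" and ss: "\<And>i j. i < n \<Longrightarrow> j < n \<Longrightarrow> 0 \<le> x i * x j"
  shows "quad n E x \<le> - sq_norm n x"
proof -
  have "adj_sum n E (\<lambda>i j. x i * x j) \<le> (\<Sum>i<n. \<Sum>j<n. x i * x j - (if j = i then (x i)\<^sup>2 else 0))"
    unfolding adj_sum_def using G ss
    by (intro sum_mono) (auto simp: simple_graph_def power2_eq_square)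
  also have "\<dots> = (vsum n x)\<^sup>2 - sq_norm n x"
    by (simp add: sum_subtractf vsum_def sq_norm_def power2_eq_square sum_product)
  finally show ?thesis by (simp add: quad_def)
qed

lemma sum_partition:
  assumes "P \<union> N = {..<n::nat}" "P \<inter> N = {}"
  shows "(\<Sum>i<n. f i) = sum f P + (sum f N :: real)"
  using assms by (metis finite_Un finite_lessThan sum.union_disjoint)

text \<open>The extra edge \<open>k l\<close> adds at most the squares of the entries of
  \<open>N\<close> other than \<open>x r2\<close>. Completing squares then leaves the norm minus
  three squares.\<close>

lemma quad_bound_single:
  assumes E: "simple_graph n E" "E k l" and S: "signed_tree n (del_edge E k l) P N x r1 i0 r2 j0"
    and kl: "k \<in> N - {r2} \<and> l \<in> N - {r2} \<and> k \<noteq> l \<or> x k * x l \<le> 0" and P1: "P = {r1}"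
  shows "quad n E x \<le> sq_norm n x"
proof -
  interpret signed_tree n "del_edge E k l" P N x r1 i0 r2 j0 by (rule S)
  have fin: "finite N" using PN by (metis finite_Un finite_lessThan)
  let ?V = "\<Sum>i\<in>N. (x i)\<^sup>2"
  have V: "2 * (x k * x l) \<le> ?V - (x r2)\<^sup>2"
  proof -
    have eq: "?V - (x r2)\<^sup>2 = (\<Sum>i\<in>N - {r2}. (x i)\<^sup>2)" using fin mem by (simp add: sum_diff1)
    show ?thesis
    proof (cases "k \<in> N - {r2} \<and> l \<in> N - {r2} \<and> k \<noteq> l")
      case True
      have "(\<Sum>i\<in>{k, l}. (x i)\<^sup>2) \<le> (\<Sum>i\<in>N - {r2}. (x i)\<^sup>2)" using True fin by (intro sum_mono2) auto
      then show ?thesis unfolding eq using True sum_squares_bound[of "x k" "x l"] by simp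
    next
      case False
      then have "x k * x l \<le> 0" using kl by blast
      moreover have "0 \<le> (\<Sum>i\<in>N - {r2}. (x i)\<^sup>2)" by (intro sum_nonneg) auto
      ultimately show ?thesis unfolding eq by linarith
    qed
  qed
  have tot: "vsum n x = x r1 + sum x N" "sq_norm n x = (x r1)\<^sup>2 + ?V"
    unfolding vsum_def sq_norm_def sum_partition[OF PN] P1 by simp_all
  have "x i0 * x j0 \<le> 0" using P(1)[OF mem(2)] N(1)[OF mem(4)] by (rule mult_nonneg_nonpos)
  then have "adj_sum n E (\<lambda>i j. x i * x j) \<le> 2 * x r2 * (sum x N - x r2) + 2 * (x k * x l)"
    using sum_bound unfolding adj_sum_del_edge[OF E] P1 by simp
  then have "quad n E x \<le> 2 * x r2 * (sum x N - x r2) + (?V - (x r2)\<^sup>2) - (x r1 + sum x N)\<^sup>2"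
    unfolding quad_def tot using V by linarith
  also have "\<dots> = (x r1)\<^sup>2 + ?V - (x r2 - (x r1 + sum x N))\<^sup>2 - (x r2 + x r1)\<^sup>2 - (x r2)\<^sup>2"
    by (simp add: power2_eq_square algebra_simps)
  also have "\<dots> \<le> (x r1)\<^sup>2 + ?V"
    using zero_le_power2[of "x r2 - (x r1 + sum x N)"] zero_le_power2[of "x r2 + x r1"] zero_le_power2[of "x r2"]
    by linarith
  finally show ?thesis unfolding tot .
qed

text \<open>The star bound on \<open>N\<close> together with the edge \<open>k l\<close> is the
  value of a triangle, \<open>s^2 - V\<close>.\<close>

lemma quad_bound_triple:
  assumes E: "simple_graph n E" "E k l" and S: "signed_tree n (del_edge E k l) P N x r1 i0 r2 j0"
    and N3: "N = {r2, k, l}" and ne: "r2 \<noteq> k" "r2 \<noteq> l" "k \<noteq> l"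
  shows "quad n E x \<le> 3 * sq_norm n x"
proof -
  interpret signed_tree n "del_edge E k l" P N x r1 i0 r2 j0 by (rule S)
  have fin: "finite P" using PN by (metis finite_Un finite_lessThan)
  define V where "V = (x r2)\<^sup>2 + (x k)\<^sup>2 + (x l)\<^sup>2"
  define s where "s = x r2 + x k + x l"
  define a where "a = x r1"
  have tot: "vsum n x = sum x P + s" "sq_norm n x = (\<Sum>i\<in>P. (x i)\<^sup>2) + V"
    unfolding vsum_def sq_norm_def sum_partition[OF PN] N3 using ne by (simp_all add: s_def V_def)
  have Pa: "a\<^sup>2 \<le> (\<Sum>i\<in>P. (x i)\<^sup>2)" unfolding a_def using fin mem by (intro member_le_sum) auto
  have sV: "s\<^sup>2 \<le> 3 * V"
  proof -
    have "0 \<le> (x r2 - x k)\<^sup>2 + (x r2 - x l)\<^sup>2 + (x k - x l)\<^sup>2" by simp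
    also have "\<dots> = 3 * V - s\<^sup>2" by (simp add: V_def s_def power2_eq_square algebra_simps)
    finally show ?thesis by simp
  qed
  have "x i0 * x j0 \<le> 0" using P(1)[OF mem(2)] N(1)[OF mem(4)] by (rule mult_nonneg_nonpos)
  then have "adj_sum n E (\<lambda>i j. x i * x j)
      \<le> 2 * a * (sum x P - a) + 2 * x r2 * (sum x N - x r2) + 2 * (x k * x l)"
    using sum_bound unfolding adj_sum_del_edge[OF E] a_def by linarith
  moreover have "2 * x r2 * (sum x N - x r2) + 2 * (x k * x l) = s\<^sup>2 - V"
    unfolding N3 using ne by (simp add: s_def V_def power2_eq_square algebra_simps)
  ultimately have "quad n E x \<le> 2 * a * (sum x P - a) + (s\<^sup>2 - V) - (sum x P + s)\<^sup>2"
    unfolding quad_def tot by linarith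
  \<comment> \<open>Only squares and the Cauchy-Schwarz defect \<open>3 * V - s^2\<close> are
    subtracted.\<close>
  also have "\<dots> = 3 * a\<^sup>2 + 3 * V - (a - (sum x P + s))\<^sup>2 - (2 * a + s / 2)\<^sup>2 - s\<^sup>2 / 12 - 4 / 3 * (3 * V - s\<^sup>2)"
    by (simp add: power2_eq_square algebra_simps field_simps)
  also have "\<dots> \<le> 3 * a\<^sup>2 + 3 * V" 
  proof -
    have "X - A - B - C / 12 - 4 / 3 * (3 * V - C) \<le> X" if "0 \<le> A" "0 \<le> B" "0 \<le> C" "C \<le> 3 * V"
      for X A B C :: real
      using that by (simp add: field_simps)
    then show ?thesis using sV by simp
  qed
  also have "\<dots> \<le> 3 * sq_norm n x" unfolding tot using Pa by simp
  finally show ?thesis .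
qed

text \<open>Listing \<open>P\<close> as \<open>r1, i0, ...\<close> and \<open>N\<close> as
  \<open>r2, k2, k3, ..., j0\<close> puts each vertex at the index of its role in
  \<open>U_edge\<close>.\<close>

lemma relabelling_exists:
  assumes PN: "P \<union> N = {..<n::nat}" "P \<inter> N = {}"
    and P: "r1 \<in> P" "i0 \<in> P" "r1 \<noteq> i0"
    and N: "r2 \<in> N" "k2 \<in> N" "k3 \<in> N" "j0 \<in> N" "distinct [r2, k2, k3, j0]"
  shows "\<exists>\<sigma> p q. p \<ge> 1 \<and> q \<ge> 3 \<and> p + q + 2 = n \<and> bij_betw \<sigma> {..<n} {..<n} \<and>
    bij_betw \<sigma> {..p} P \<and> bij_betw \<sigma> {p + 1..p + q + 1} N \<and>
    \<sigma> 0 = r1 \<and> \<sigma> 1 = i0 \<and> \<sigma> (p + 1) = r2 \<and> \<sigma> (p + 2) = k2 \<and> \<sigma> (p + 3) = k3 \<and> \<sigma> (p + q + 1) = j0"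
proof -
  have fin: "finite P" "finite N" using PN by (metis finite_Un finite_lessThan)+
  obtain xs where xs: "set xs = P - {r1, i0}" "distinct xs" using fin finite_distinct_list[of "P - {r1, i0}"] by auto
  obtain ys where ys: "set ys = N - {r2, k2, k3, j0}" "distinct ys"
    using fin finite_distinct_list[of "N - {r2, k2, k3, j0}"] by auto
  define p where "p = length xs + 1"
  define q where "q = length ys + 3"
  define L1 where "L1 = r1 # i0 # xs"
  define L2 where "L2 = r2 # k2 # k3 # ys @ [j0]"
  define L where "L = L1 @ L2"
  have l: "length L1 = p + 1" "length L2 = q + 1" by (auto simp: L1_def L2_def p_def q_def)
  have s: "set L1 = P" "set L2 = N" "distinct L1" "distinct L2"
    using xs ys P N by (auto simp: L1_def L2_def)
  then have d: "distinct L" "set L = {..<n}" using PN by (auto simp: L_def)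
  then have len: "length L = n" by (metis card_lessThan distinct_card)
  have bij: "bij_betw ((!) L) {..<n} {..<n}" using bij_betw_nth[OF d(1) refl refl] d(2) len by simp
  have inj: "inj_on ((!) L) {..<n}" using bij by (rule bij_betw_imp_inj_on)
  have n: "p + q + 2 = n" using len l by (simp add: L_def)
  have i1: "(!) L ` {..p} = P"
  proof -
    have "(!) L ` {..p} = (!) L1 ` {..<p + 1}" using l
      by (intro image_cong) (auto simp: L_def nth_append)
    then show ?thesis using s(1) l(1) by (auto simp: set_conv_nth)
  qed
  have i2: "(!) L ` {p + 1..p + q + 1} = N"
  proof -
    have "{..<n} = {..p} \<union> {p + 1..p + q + 1}" using n by auto
    then have "(!) L ` {..p} \<union> (!) L ` {p + 1..p + q + 1} = P \<union> N"
      using bij PN by (metis bij_betw_imp_surj_on image_Un)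
    moreover have "(!) L ` {..p} \<inter> (!) L ` {p + 1..p + q + 1} = {}"
    proof -
      have "(!) L ` ({..p} \<inter> {p + 1..p + q + 1}) = (!) L ` {..p} \<inter> (!) L ` {p + 1..p + q + 1}"
        using n by (intro inj_on_image_Int[OF inj]) auto
      moreover have "{..p} \<inter> {p + 1..p + q + 1} = {}" by auto
      ultimately show ?thesis by simp
    qed
    ultimately show ?thesis using i1 PN by blast
  qed
  have b1: "bij_betw ((!) L) {..p} P" and b2: "bij_betw ((!) L) {p + 1..p + q + 1} N"
    using i1 i2 inj n by (auto simp: bij_betw_def intro: inj_on_subset)
  have v: "L ! 0 = r1" "L ! 1 = i0" "L ! (p + 1) = r2" "L ! (p + 2) = k2" "L ! (p + 3) = k3" "L ! (p + q + 1) = j0"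
    by (auto simp: L_def L1_def L2_def p_def q_def nth_append numeral_eq_Suc)
  show ?thesis
    by (rule exI[of _ "(!) L"], rule exI[of _ p], rule exI[of _ q])
      (intro conjI n bij b1 b2 v; simp add: p_def q_def)
qed

section \<open>Comparison of a unicyclic graph with \<open>U(p,q)\<close>\<close>

lemma finite_argmin:
  fixes x :: "nat \<Rightarrow> real"
  assumes "finite A" "A \<noteq> {}"
  shows "\<exists>i\<in>A. \<forall>j\<in>A. x i \<le> x j"
  using assms by (metis arg_min_if_finite(1) arg_min_least)

lemma finite_argmax:
  fixes x :: "nat \<Rightarrow> real"
  assumes "finite A" "A \<noteq> {}"
  shows "\<exists>i\<in>A. \<forall>j\<in>A. x j \<le> x i"
  using finite_argmin[OF assms, of "\<lambda>i. - x i"] by simp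

text \<open>On the transported vector \<open>U(p,q)\<close> realises the tree bound exactly, and its
  triangle edge \<open>k2 k3\<close> takes the place of \<open>k l\<close>; apart from
  \<open>r2\<close>, the vertices \<open>k2\<close>, \<open>k3\<close> have the largest moduli in
  \<open>N\<close>. The four vertices with special roles in \<open>N\<close> require
  \<open>card N \<ge> 4\<close>.\<close>

lemma relabelled_bound:
  assumes E: "simple_graph n E" "E k l" and T: "is_tree n (del_edge E k l)"
    and PN: "P \<union> N = {..<n}" "P \<inter> N = {}"
    and xP: "\<forall>i\<in>P. 0 \<le> x i" and xN: "\<forall>i\<in>N. x i \<le> 0"
    and r2: "r2 \<in> N" "\<forall>i\<in>N. x r2 \<le> x i"
    and kl: "k \<in> N - {r2} \<and> l \<in> N - {r2} \<and> k \<noteq> l \<or> x k * x l \<le> 0"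
    and card: "card P \<ge> 2" "card N \<ge> 4"
  shows "\<exists>\<sigma> p q. p \<ge> 1 \<and> q \<ge> 3 \<and> p + q + 2 = n \<and> bij_betw \<sigma> {..<n} {..<n} \<and>
    quad n E x \<le> quad n (U_edge p q) (\<lambda>i. x (\<sigma> i)) \<and>
    (\<forall>i\<le>p. 0 \<le> x (\<sigma> i) \<and> x (\<sigma> i) \<le> x (\<sigma> 0)) \<and>
    (\<forall>i\<in>{p + 1..p + q + 1}. x (\<sigma> i) \<le> 0 \<and> x (\<sigma> (p + 1)) \<le> x (\<sigma> i)) \<and>
    (quad n E x = quad n (U_edge p q) (\<lambda>i. x (\<sigma> i)) \<longrightarrow> strict_profile p q (\<lambda>i. x (\<sigma> i)) \<longrightarrow>
      (\<forall>i<n. \<forall>j<n. E (\<sigma> i) (\<sigma> j) \<longleftrightarrow> U_edge p q i j))"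
proof -
  have fin: "finite P" "finite N" using PN by (metis finite_Un finite_lessThan)+
  have ne: "A - B \<noteq> {}" if "finite A" "finite B" "card B < card A" for A B :: "nat set"
    using that by (metis Diff_eq_empty_iff card_mono leD)
  have "P \<noteq> {}" using card by auto
  then obtain r1 where r1: "r1 \<in> P" "\<And>i. i \<in> P \<Longrightarrow> x i \<le> x r1" using finite_argmax[OF fin(1), of x] by blast
  \<comment> \<open>\<open>i0\<close> must differ from \<open>r1\<close> even when entries tie, so
    \<open>r1\<close> is removed first; \<open>i0\<close> is still minimal on all of
    \<open>P\<close>. The choice of \<open>j0\<close> follows the same pattern.\<close>
  obtain i0 where i0: "i0 \<in> P - {r1}" "\<And>i. i \<in> P - {r1} \<Longrightarrow> x i0 \<le> x i"
    using finite_argmin[OF _ ne[of P "{r1}"], of x] fin card by auto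
  obtain k2 where k2: "k2 \<in> N - {r2}" "\<And>i. i \<in> N - {r2} \<Longrightarrow> x k2 \<le> x i"
    using finite_argmin[OF _ ne[of N "{r2}"], of x] fin card by auto
  have "card {r2, k2} < card N" using card card_length[of "[r2, k2]"] by simp
  then obtain k3 where k3: "k3 \<in> N - {r2, k2}" "\<And>i. i \<in> N - {r2, k2} \<Longrightarrow> x k3 \<le> x i"
    using finite_argmin[OF _ ne[of N "{r2, k2}"], of x] fin by auto
  have "card {r2, k2, k3} < card N" using card card_length[of "[r2, k2, k3]"] by simp
  then obtain j0 where j0: "j0 \<in> N - {r2, k2, k3}" "\<And>i. i \<in> N - {r2, k2, k3} \<Longrightarrow> x i \<le> x j0"
    using finite_argmax[OF _ ne[of N "{r2, k2, k3}"], of x] fin by auto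
  have i0': "x i0 \<le> x i" if "i \<in> P" for i using i0 r1 that by (cases "i = r1") auto
  have j0': "x i \<le> x j0" if i: "i \<in> N" for i
  proof -
    consider "i = r2" | "i = k2" | "i = k3" | "i \<in> N - {r2, k2, k3}" using i by blast
    then show ?thesis using r2 k2 k3 j0 by cases auto
  qed
  interpret signed_tree n "del_edge E k l" P N x r1 i0 r2 j0
    by unfold_locales (use T PN r1 i0 i0' r2 j0 j0' xP xN in auto)
  have dist: "distinct [r2, k2, k3, j0]" using k2 k3 j0 by auto
  have mem': "r1 \<noteq> i0" "k2 \<in> N" "k3 \<in> N" using i0 k2 k3 by auto
  note rel = relabelling_exists[OF PN mem(1,2) mem'(1) mem(3) mem'(2,3) mem(4) dist]
  obtain \<sigma> p q where pq: "p \<ge> 1" "q \<ge> 3" and n: "p + q + 2 = n" and bij: "bij_betw \<sigma> {..<n} {..<n}"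
    and b1: "bij_betw \<sigma> {..p} P" and b2: "bij_betw \<sigma> {p + 1..p + q + 1} N"
    and \<sigma>: "\<sigma> 0 = r1" "\<sigma> 1 = i0" "\<sigma> (p + 1) = r2" "\<sigma> (p + 2) = k2" "\<sigma> (p + 3) = k3" "\<sigma> (p + q + 1) = j0"
    using rel by (elim exE conjE) (rule that)
  have mP: "\<sigma> i \<in> P" if "i \<le> p" for i using b1 that by (auto simp: bij_betw_def)
  have mN: "\<sigma> i \<in> N" if "i \<in> {p + 1..p + q + 1}" for i using b2 that by (auto simp: bij_betw_def)
  have SP: "(\<Sum>i\<in>{1..p}. x (\<sigma> i)) = sum x P - x r1"
  proof -
    have "{..p} = insert 0 {1..p}" by auto
    then have "(\<Sum>i\<in>{..p}. x (\<sigma> i)) = x r1 + (\<Sum>i\<in>{1..p}. x (\<sigma> i))" using \<sigma> by simp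
    then show ?thesis using sum.reindex_bij_betw[OF b1, of x] by simp
  qed
  have SN: "(\<Sum>i\<in>{p + 2..p + q + 1}. x (\<sigma> i)) = sum x N - x r2"
  proof -
    have "{p + 1..p + q + 1} = insert (p + 1) {p + 2..p + q + 1}" by auto
    then have "(\<Sum>i\<in>{p + 1..p + q + 1}. x (\<sigma> i)) = x r2 + (\<Sum>i\<in>{p + 2..p + q + 1}. x (\<sigma> i))"
      using \<sigma> by simp
    then show ?thesis using sum.reindex_bij_betw[OF b2, of x] by simp
  qed
  have AU: "adj_sum n (U_edge p q) (\<lambda>i j. x (\<sigma> i) * x (\<sigma> j))
    = 2 * x r1 * (sum x P - x r1) + 2 * x r2 * (sum x N - x r2) + 2 * (x i0 * x j0) + 2 * (x k2 * x k3)"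
    using adj_sum_U_edge[OF pq, of "\<lambda>i. x (\<sigma> i)"] unfolding n SP SN \<sigma> by (simp add: algebra_simps)
  have vs: "vsum n (\<lambda>i. x (\<sigma> i)) = vsum n x"
    unfolding vsum_def by (rule sum.reindex_bij_betw[OF bij])
  have k23: "0 \<le> x k2 * x k3" using xN k2 k3 by (simp add: mult_nonpos_nonpos)
  \<comment> \<open>If both ends lie in \<open>N - {r2}\<close>, one of them differs from
    \<open>k2\<close> and has modulus at most that of \<open>k3\<close>; otherwise the left side is
    non-positive.\<close>
  have w: "x k * x l \<le> x k2 * x k3"
  proof (cases "k \<in> N - {r2} \<and> l \<in> N - {r2} \<and> k \<noteq> l")
    case True
    have aux: "x i * x j \<le> x k2 * x k3" if "i \<in> N - {r2}" "j \<in> N - {r2, k2}" for i j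
    proof -
      have "(- x i) * (- x j) \<le> (- x k2) * (- x k3)"
        using k2 k3 xN that by (intro mult_mono) auto
      then show ?thesis by simp
    qed
    show ?thesis
    proof (cases "l = k2")
      case True
      then have "x l * x k \<le> x k2 * x k3" using \<open>k \<in> N - {r2} \<and> _\<close> by (intro aux) auto
      then show ?thesis by (simp add: mult.commute)
    next
      case False
      then show ?thesis using True by (intro aux) auto
    qed
  next
    case False
    then show ?thesis using kl k23 by linarith
  qed
  have le: "quad n E x \<le> quad n (U_edge p q) (\<lambda>i. x (\<sigma> i))"
    unfolding quad_def vs AU adj_sum_del_edge[OF E] using sum_bound w by linarith
  have eq: "E (\<sigma> i) (\<sigma> j) \<longleftrightarrow> U_edge p q i j"
    if Q: "quad n E x = quad n (U_edge p q) (\<lambda>i. x (\<sigma> i))" and st: "strict_profile p q (\<lambda>i. x (\<sigma> i))"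
      and ij: "i < n" "j < n" for i j
  proof -
    have st': "0 < x i0" "x i0 < x r1" "\<And>k. k \<in> {2..p} \<Longrightarrow> x i0 < x (\<sigma> k) \<and> x (\<sigma> k) < x r1"
      "x r2 < x k2" "x k3 = x k2" "x k2 < x j0"
      "\<And>k. k \<in> {p + 4..p + q} \<Longrightarrow> x k2 < x (\<sigma> k) \<and> x (\<sigma> k) < x j0" "x j0 < 0"
      using st unfolding strict_profile_def \<sigma> by blast+
    \<comment> \<open>The tree part and the extra edge are bounded separately, so equality of the
      forms makes both bounds tight.\<close>
    have eqH: "adj_sum n (del_edge E k l) (\<lambda>i j. x i * x j)
      = 2 * x r1 * (sum x P - x r1) + 2 * x r2 * (sum x N - x r2) + 2 * (x i0 * x j0)"
      and wkl: "x k * x l = x k2 * x k3"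
      using Q sum_bound w unfolding quad_def vs AU adj_sum_del_edge[OF E] by linarith+
    have sP: "(i \<noteq> r1 \<longrightarrow> x i < x r1) \<and> (i \<noteq> i0 \<longrightarrow> x i0 < x i)" if iP: "i \<in> P" for i
    proof -
      have "i \<in> \<sigma> ` {..p}" using iP b1 by (simp add: bij_betw_def)
      then obtain i' where i': "i' \<le> p" "i = \<sigma> i'" by auto
      then consider "i' = 0" | "i' = 1" | "i' \<in> {2..p}" by fastforce
      then show ?thesis using i' \<sigma> st' by cases auto
    qed
    have sN: "(i \<noteq> r2 \<longrightarrow> x r2 < x i) \<and> (i \<noteq> j0 \<longrightarrow> x i < x j0) \<and> (i \<notin> {r2, k2, k3} \<longrightarrow> x k2 < x i)" if iN: "i \<in> N" for i
    proof -
      have "i \<in> \<sigma> ` {p + 1..p + q + 1}" using iN b2 by (simp add: bij_betw_def)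
      then obtain i' where i': "i' \<in> {p + 1..p + q + 1}" "i = \<sigma> i'" by blast
      then consider "i' = p + 1" | "i' = p + 2" | "i' = p + 3" | "i' \<in> {p + 4..p + q}" | "i' = p + q + 1" by fastforce
      then show ?thesis using i' \<sigma> st' by cases fastforce+
    qed
    have HH: "del_edge E k l v w \<longleftrightarrow> v \<noteq> w \<and> (v \<in> P \<and> w \<in> P \<and> (v = r1 \<or> w = r1)
        \<or> v \<in> N \<and> w \<in> N \<and> (v = r2 \<or> w = r2) \<or> {v, w} = {i0, j0})" if "v < n" "w < n" for v w
      by (rule sum_bound_eq[OF eqH st'(1,8)]) (use sP sN that in auto)
    have "0 < x k2 * x k3" using st' by (simp add: mult_neg_neg)
    \<comment> \<open>A positive weight rules out the alternative
      \<open>x k * x l \<le> 0\<close>.\<close>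
    then have klN: "k \<in> N - {r2}" "l \<in> N - {r2}" "k \<noteq> l" using kl wkl by auto
    \<comment> \<open>An end outside \<open>{k2, k3}\<close> would make the product strictly
      smaller.\<close>
    have aux: "a \<in> {k2, k3}" if a: "a \<in> N - {r2}" "b \<in> N - {r2}" "x a * x b = x k2 * x k3" for a b
    proof (rule ccontr)
      assume "a \<notin> {k2, k3}"
      then have "x k2 < x a" using sN a by blast
      moreover have "x b < 0" using j0'[of b] a(2) st'(8) by simp
      ultimately have "x a * x b < x k2 * x b" by (simp add: mult_strict_right_mono_neg)
      also have "\<dots> \<le> x k2 * x k3"
        using k2(2)[OF a(2)] st' by (simp add: mult_left_mono_neg)
      finally show False using a(3) by simp
    qed
    have "{k, l} = {k2, k3}"
      using aux[OF klN(1,2) wkl] aux[OF klN(2,1)] wkl klN(3) by (auto simp: mult.commute)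
    then have EH: "E v w \<longleftrightarrow> del_edge E k l v w \<or> {v, w} = {k2, k3}" for v w
      using E unfolding del_edge_def simple_graph_def by (metis doubleton_eq_iff)
    have inj: "\<sigma> i = \<sigma> j \<longleftrightarrow> i = j" if "i < n" "j < n" for i j
      using bij that by (auto simp: bij_betw_def inj_on_def)
    have lt: "0 < n" "1 < n" "p + 1 < n" "p + 2 < n" "p + 3 < n" "p + q + 1 < n" using n pq by auto
    have inP: "\<sigma> i \<in> P \<longleftrightarrow> i \<le> p" if "i < n" for i
      using mP[of i] mN[of i] PN(2) that n by fastforce
    have inN: "\<sigma> i \<in> N \<longleftrightarrow> p + 1 \<le> i" if "i < n" for i
      using mP[of i] mN[of i] PN(2) that n by fastforce
    have sn: "\<sigma> i < n" if "i < n" for i using bij that by (auto simp: bij_betw_def)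
    have I: "\<sigma> i = r1 \<longleftrightarrow> i = 0" "\<sigma> i = i0 \<longleftrightarrow> i = 1" "\<sigma> i = r2 \<longleftrightarrow> i = p + 1" "\<sigma> i = k2 \<longleftrightarrow> i = p + 2"
      "\<sigma> i = k3 \<longleftrightarrow> i = p + 3" "\<sigma> i = j0 \<longleftrightarrow> i = p + q + 1" if "i < n" for i
      unfolding \<sigma>[symmetric] using inj[OF that] lt by auto
    have "E (\<sigma> i) (\<sigma> j) \<longleftrightarrow> (i \<noteq> j \<and> i \<le> p \<and> j \<le> p \<and> (i = 0 \<or> j = 0))
        \<or> (i \<noteq> j \<and> p + 1 \<le> i \<and> p + 1 \<le> j \<and> (i = p + 1 \<or> j = p + 1))
        \<or> (i = p + 2 \<and> j = p + 3 \<or> i = p + 3 \<and> j = p + 2)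
        \<or> (i \<noteq> j \<and> (i = 1 \<and> j = p + q + 1 \<or> i = p + q + 1 \<and> j = 1))"
      unfolding EH HH[OF sn[OF ij(1)] sn[OF ij(2)]] doubleton_eq_iff inj[OF ij]
        inP[OF ij(1)] inP[OF ij(2)] inN[OF ij(1)] inN[OF ij(2)] I[OF ij(1)] I[OF ij(2)] by blast
    also have "\<dots> \<longleftrightarrow> U_edge p q i j"
    proof -
      have 1: "(i \<noteq> j \<and> i \<le> p \<and> j \<le> p \<and> (i = 0 \<or> j = 0)) \<longleftrightarrow>
          i = 0 \<and> 1 \<le> j \<and> j \<le> p \<or> j = 0 \<and> 1 \<le> i \<and> i \<le> p"
        by auto
      have 2: "(i \<noteq> j \<and> p + 1 \<le> i \<and> p + 1 \<le> j \<and> (i = p + 1 \<or> j = p + 1)) \<longleftrightarrow>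
          i = p + 1 \<and> p + 2 \<le> j \<and> j \<le> p + q + 1 \<or> j = p + 1 \<and> p + 2 \<le> i \<and> i \<le> p + q + 1"
        using ij n by auto
      have 3: "(i \<noteq> j \<and> (i = 1 \<and> j = p + q + 1 \<or> i = p + q + 1 \<and> j = 1)) \<longleftrightarrow>
          i = 1 \<and> j = p + q + 1 \<or> i = p + q + 1 \<and> j = 1"
        using pq by auto
      show ?thesis unfolding U_edge_iff[OF pq] 1 2 3 by (simp only: disj_assoc)
    qed
    finally show ?thesis .
  qed
  show ?thesis
  proof (rule exI[of _ \<sigma>], rule exI[of _ p], rule exI[of _ q], intro conjI)
    show "\<forall>i\<le>p. 0 \<le> x (\<sigma> i) \<and> x (\<sigma> i) \<le> x (\<sigma> 0)" using mP xP r1 \<sigma> by auto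
    show "\<forall>i\<in>{p + 1..p + q + 1}. x (\<sigma> i) \<le> 0 \<and> x (\<sigma> (p + 1)) \<le> x (\<sigma> i)" using mN xN r2 \<sigma> by auto
  qed (use pq n bij le eq in auto)
qed

section \<open>The extremal graph\<close>

text \<open>If \<open>r\<close> is on the cycle, the edge starting at its successor avoids it; the
  cases follow the wrap-around of indices.\<close>

lemma cycle_edge_avoiding:
  assumes L: "3 \<le> length vs" and d: "distinct vs"
  obtains i where "i < length vs" "vs ! i \<noteq> r" "vs ! ((i + 1) mod length vs) \<noteq> r"
proof -
  have nth_ne: "vs ! a \<noteq> vs ! b" if "a < length vs" "b < length vs" "a \<noteq> b" for a b
    using d that by (simp add: nth_eq_iff_index_eq)
  have "\<exists>i<length vs. vs ! i \<noteq> r \<and> vs ! ((i + 1) mod length vs) \<noteq> r"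
  proof (cases "r \<in> set vs")
    case True
    then obtain t where t: "t < length vs" "r = vs ! t" by (metis in_set_conv_nth)
    consider "t + 2 < length vs" | "t + 2 = length vs" | "t + 1 = length vs" using t(1) by linarith
    then show ?thesis
    proof cases
      case 1
      then show ?thesis unfolding t(2) using nth_ne t(1) by (intro exI[of _ "t + 1"]) simp
    next
      case 2
      then have m: "(t + 1 + 1) mod length vs = 0" and "0 \<noteq> t" "0 < length vs" "t + 1 < length vs" using L by auto
      then show ?thesis unfolding t(2) using nth_ne[OF \<open>0 < length vs\<close> t(1)] nth_ne[OF \<open>t + 1 < length vs\<close> t(1)]
        by (intro exI[of _ "t + 1"]) (simp only: m, simp)
    next
      case 3
      then have lt: "0 < length vs" "1 < length vs" and "0 \<noteq> t" "1 \<noteq> t" using L by linarith+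
      moreover have m: "(0 + 1) mod length vs = 1" using lt by simp
      ultimately show ?thesis unfolding t(2) using nth_ne[OF lt(1) t(1)] nth_ne[OF lt(2) t(1)]
        by (intro exI[of _ 0]) (simp only: m, simp)
    qed
  next
    case False
    have "0 < length vs" "1 < length vs" using L by linarith+
    then have m: "(0 + 1) mod length vs = 1" and "vs ! 0 \<in> set vs" "vs ! 1 \<in> set vs"
      by (simp, blast intro: nth_mem, blast intro: nth_mem)
    then show ?thesis using False \<open>0 < length vs\<close> by (intro exI[of _ 0]) (simp only: m, auto)
  qed
  then show ?thesis using that by blast
qed

text \<open>The equivalence covers both orientations of a crossing. Without such an edge, membership
  in \<open>P\<close> would be constant along the cycle.\<close>

lemma cycle_edge_crossing:
  assumes "vs \<noteq> []" "\<not> set vs \<subseteq> P" "\<not> set vs \<subseteq> N" and PN: "set vs \<subseteq> P \<union> N" "P \<inter> N = {}"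
  obtains i where "i < length vs" "vs ! i \<in> P \<longleftrightarrow> vs ! ((i + 1) mod length vs) \<in> N"
proof -
  have mem: "v \<in> N \<longleftrightarrow> v \<notin> P" if "v \<in> set vs" for v using PN that by blast
  have "\<exists>i<length vs. vs ! i \<in> P \<longleftrightarrow> vs ! ((i + 1) mod length vs) \<in> N"
  proof (rule ccontr)
    assume "\<not> ?thesis"
    then have step: "vs ! i \<in> P \<longleftrightarrow> vs ! Suc i \<in> P" if "Suc i < length vs" for i
      using that mem[of "vs ! Suc i"] by (metis Suc_eq_plus1 Suc_lessD mod_less nth_mem)
    have "vs ! i \<in> P \<longleftrightarrow> vs ! 0 \<in> P" if "i < length vs" for i
      using that
    proof (induction i)
      case (Suc i)
      then show ?case using step[of i] by simp
    qed simp
    then have "v \<in> P \<longleftrightarrow> vs ! 0 \<in> P" if "v \<in> set vs" for v using that by (metis in_set_conv_nth)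
    then show False using assms(2,3) mem by blast
  qed
  then show ?thesis using that by blast
qed

text \<open>The inequalities \<open>\<mu> \<le> colambda n (U_edge p q) \<le> colambda n (U_edge p'
  q') \<le> \<mu>\<close> become equalities. This identifies \<open>(p,q)\<close> with
  \<open>(p',q')\<close> and makes the transported vector an eigenvector, so the equality case of
  the comparison applies.\<close>

lemma relabelling_if_colambda_ge:
  assumes U: "unicyclic n E" and bal: "balanced p' q'" "q' \<ge> 9" and n: "p' + q' + 2 = n"
    and ev: "eigvec n E \<mu> x" and nz: "\<exists>i<n. x i \<noteq> 0" and ge: "colambda n (U_edge p' q') \<le> \<mu>"
    and PN: "P \<union> N = {..<n}" "P \<inter> N = {}"
    and xP: "\<And>i. i \<in> P \<Longrightarrow> 0 \<le> x i" and xN: "\<And>i. i \<in> N \<Longrightarrow> x i \<le> 0"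
    and vs: "3 \<le> length vs" "distinct vs" "set vs \<subseteq> {0..<n}"
    and cyc: "\<And>i. i < length vs \<Longrightarrow> E (vs ! i) (vs ! ((i + 1) mod length vs))"
    and del: "\<And>i k l. i < length vs \<Longrightarrow> k = vs ! i \<Longrightarrow> l = vs ! ((i + 1) mod length vs) \<Longrightarrow>
       connected_graph n (del_edge E k l) \<and> (\<forall>C. \<not> cycle_edge_set n (del_edge E k l) C)"
    and side: "set vs \<subseteq> N \<or> \<not> set vs \<subseteq> P \<and> \<not> set vs \<subseteq> N \<and> card N \<ge> 4"
  shows "\<exists>\<sigma>. bij_betw \<sigma> {..<n} {..<n} \<and> (\<forall>i<n. \<forall>j<n. E (\<sigma> i) (\<sigma> j) \<longleftrightarrow> U_edge p' q' i j)"
proof -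
  have G: "simple_graph n E" using U by (simp add: unicyclic_def)
  have fin: "finite P" "finite N" using PN by (metis finite_Un finite_lessThan)+
  have p': "p' \<ge> 9" using bal by (auto simp: balanced_def)
  have \<mu>3: "\<mu> > 3" using colambda_balanced_gt_3[OF p' bal(2)] ge n by simp
  have sq: "sq_norm n x > 0" using nz sq_norm_pos by blast
  have Q: "quad n E x = \<mu> * sq_norm n x" by (rule quad_eigvec[OF ev])
  have big: "3 * sq_norm n x < quad n E x" unfolding Q using \<mu>3 sq by simp
  have vs0: "vs \<noteq> []" using vs(1) by auto
  have Nne: "N \<noteq> {}" using side vs0 by auto
  have Pne: "P \<noteq> {}"
  proof
    assume "P = {}"
    then have "x i \<le> 0" if "i < n" for i using PN xN that by auto
    then have "quad n E x \<le> - sq_norm n x" by (intro quad_same_sign[OF G] mult_nonpos_nonpos)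
    then show False using big sq by simp
  qed
  obtain r1 where r1: "r1 \<in> P" "\<And>i. i \<in> P \<Longrightarrow> x i \<le> x r1" using finite_argmax[OF fin(1) Pne, of x] by blast
  obtain i0 where i0: "i0 \<in> P" "\<And>i. i \<in> P \<Longrightarrow> x i0 \<le> x i" using finite_argmin[OF fin(1) Pne, of x] by blast
  obtain r2 where r2: "r2 \<in> N" "\<And>i. i \<in> N \<Longrightarrow> x r2 \<le> x i" using finite_argmin[OF fin(2) Nne, of x] by blast
  obtain j0 where j0: "j0 \<in> N" "\<And>i. i \<in> N \<Longrightarrow> x i \<le> x j0" using finite_argmax[OF fin(2) Nne, of x] by blast
  \<comment> \<open>A cycle inside \<open>N\<close> has an edge avoiding \<open>r2\<close>; a cycle
    meeting both parts has a crossing edge, whose product is non-positive.\<close>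
  obtain i k l where i: "i < length vs" and k: "k = vs ! i" and l: "l = vs ! ((i + 1) mod length vs)"
    and kl: "k \<in> N - {r2} \<and> l \<in> N - {r2} \<or> x k * x l \<le> 0 \<and> card N \<ge> 4"
  proof (cases "set vs \<subseteq> N")
    case True
    obtain i where i: "i < length vs" "vs ! i \<noteq> r2" "vs ! ((i + 1) mod length vs) \<noteq> r2"
      using cycle_edge_avoiding[OF vs(1,2)] by blast
    have "vs ! ((i + 1) mod length vs) \<in> set vs" using vs0 by simp
    then show ?thesis using that[OF i(1) refl refl] i True nth_mem[OF i(1)] by blast
  next
    case False
    then have s: "\<not> set vs \<subseteq> P" "card N \<ge> 4" using side by auto
    have sub: "set vs \<subseteq> P \<union> N" using vs(3) PN by auto
    obtain i where i: "i < length vs" "vs ! i \<in> P \<longleftrightarrow> vs ! ((i + 1) mod length vs) \<in> N"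
      using cycle_edge_crossing[OF vs0 s(1) False sub PN(2)] by blast
    have m: "vs ! i \<in> P \<union> N" "vs ! ((i + 1) mod length vs) \<in> P \<union> N"
    proof -
      have "(i + 1) mod length vs < length vs" using vs0 by simp
      then show "vs ! i \<in> P \<union> N" "vs ! ((i + 1) mod length vs) \<in> P \<union> N"
        using nth_mem[OF i(1)] nth_mem[of _ vs] sub by blast+
    qed
    have "x (vs ! i) * x (vs ! ((i + 1) mod length vs)) \<le> 0"
    proof (cases "vs ! i \<in> P")
      case True
      then show ?thesis using i(2) xP xN by (intro mult_nonneg_nonpos) auto
    next
      case False
      then show ?thesis using i(2) m xP xN by (intro mult_nonpos_nonneg) auto
    qed
    then show ?thesis using that[OF i(1) refl refl] s(2) by blast
  qed
  have Ekl: "E k l" using cyc[OF i] k l by simp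
  have kl_ne: "k \<noteq> l" using G Ekl by (auto simp: simple_graph_def)
  have T: "is_tree n (del_edge E k l)"
    unfolding is_tree_def using simple_graph_del_edge[OF G] del[OF i k l] by blast
  have S: "signed_tree n (del_edge E k l) P N x r1 i0 r2 j0"
    by unfold_locales (use T PN r1 i0 r2 j0 xP xN in auto)
  have kl': "k \<in> N - {r2} \<and> l \<in> N - {r2} \<and> k \<noteq> l \<or> x k * x l \<le> 0" using kl kl_ne by blast
  \<comment> \<open>A single vertex in \<open>P\<close> would give
    \<open>\<mu> \<le> 1\<close>.\<close>
  have cP: "card P \<ge> 2"
  proof (rule ccontr)
    assume "\<not> ?thesis"
    moreover have "card P \<noteq> 0" using Pne fin(1) by simp
    ultimately have "card P = 1" by linarith
    then have "P = {r1}" using r1(1) by (metis card_1_singletonE singletonD)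
    then have "quad n E x \<le> sq_norm n x" by (rule quad_bound_single[OF G Ekl S kl'])
    then show False using big sq by simp
  qed
  \<comment> \<open>With fewer than four vertices in \<open>N\<close> the chosen edge avoids
    \<open>r2\<close>, so \<open>N\<close> is \<open>{r2, k, l}\<close> and
    \<open>\<mu> \<le> 3\<close>.\<close>
  have cN: "card N \<ge> 4"
  proof (rule ccontr)
    assume c: "\<not> ?thesis"
    then have "k \<in> N - {r2}" "l \<in> N - {r2}" using kl by auto
    then have sub: "{r2, k, l} \<subseteq> N" and ne: "r2 \<noteq> k" "r2 \<noteq> l" using r2 by auto
    have "card {r2, k, l} = 3" using ne kl_ne by simp
    moreover have "card {r2, k, l} \<le> card N" using sub fin(2) by (rule card_mono[rotated])
    ultimately have "card {r2, k, l} = card N" using c by linarith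
    then have "N = {r2, k, l}" using card_subset_eq[OF fin(2) sub] by simp
    then have "quad n E x \<le> 3 * sq_norm n x" by (rule quad_bound_triple[OF G Ekl S _ ne kl_ne])
    then show False using big by simp
  qed
  have signs: "\<forall>i\<in>P. 0 \<le> x i" "\<forall>i\<in>N. x i \<le> 0" "\<forall>i\<in>N. x r2 \<le> x i" using xP xN r2 by auto
  note rel = relabelled_bound[OF G Ekl T PN signs(1,2) r2(1) signs(3) kl' cP cN]
  obtain \<sigma> p q where pq: "p \<ge> 1" "q \<ge> 3" and npq: "p + q + 2 = n" and bij: "bij_betw \<sigma> {..<n} {..<n}"
    and le: "quad n E x \<le> quad n (U_edge p q) (\<lambda>i. x (\<sigma> i))"
    and sP: "\<forall>i\<le>p. 0 \<le> x (\<sigma> i) \<and> x (\<sigma> i) \<le> x (\<sigma> 0)"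
    and sN: "\<forall>i\<in>{p + 1..p + q + 1}. x (\<sigma> i) \<le> 0 \<and> x (\<sigma> (p + 1)) \<le> x (\<sigma> i)"
    and iso: "quad n E x = quad n (U_edge p q) (\<lambda>i. x (\<sigma> i)) \<longrightarrow> strict_profile p q (\<lambda>i. x (\<sigma> i)) \<longrightarrow>
      (\<forall>i<n. \<forall>j<n. E (\<sigma> i) (\<sigma> j) \<longleftrightarrow> U_edge p q i j)"
    using rel by (elim exE conjE) (rule that)
  let ?y = "\<lambda>i. x (\<sigma> i)"
  have sqy: "sq_norm n ?y = sq_norm n x" unfolding sq_norm_def by (rule sum.reindex_bij_betw[OF bij])
  have GU: "simple_graph n (U_edge p q)" using simple_graph_U_edge[OF pq] npq by simp
  have n0: "n > 0" using npq by simp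
  have ub: "quad n (U_edge p q) ?y \<le> colambda n (U_edge p q) * sq_norm n x"
    using quad_le_colambda[OF n0 GU, of ?y] unfolding sqy .
  then have "\<mu> * sq_norm n x \<le> colambda n (U_edge p q) * sq_norm n x" using le Q by linarith
  then have le\<mu>: "\<mu> \<le> colambda n (U_edge p q)" using sq by simp
  have sum: "p + q = p' + q'" using n npq by simp
  have qq: "q = q'"
  proof (rule ccontr)
    assume "q \<noteq> q'"
    then have "colambda (p + q + 2) (U_edge p q) < colambda (p' + q' + 2) (U_edge p' q')"
      by (rule colambda_lt_balanced[OF bal sum _ pq])
    then show False using le\<mu> ge unfolding n npq by linarith
  qed
  have pp: "p = p'" using sum qq by simp
  have \<mu>: "colambda n (U_edge p q) = \<mu>" using le\<mu> ge pp qq by simp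
  have Qy: "quad n (U_edge p q) ?y = \<mu> * sq_norm n x" using le ub Q \<mu> by simp
  \<comment> \<open>The transported vector attains the maximum of the Rayleigh quotient of
    \<open>U(p,q)\<close>.\<close>
  have evy: "eigvec n (U_edge p q) \<mu> ?y"
  proof (rule eigvec_if_max[OF GU])
    show "quad n (U_edge p q) y \<le> \<mu> * sq_norm n y" for y using quad_le_colambda[OF n0 GU, of y] \<mu> by simp
    show "quad n (U_edge p q) ?y = \<mu> * sq_norm n ?y" unfolding sqy by (rule Qy)
  qed
  have nzy: "\<exists>i<n. ?y i \<noteq> 0"
  proof (rule ccontr)
    assume "\<not> ?thesis"
    then have "sq_norm n ?y = 0" by (simp add: sq_norm_def)
    then show False using sq sqy by simp
  qed
  have "strict_profile p q ?y"
  proof (rule eigvec_strict_profile[OF _ _ _ \<mu>3])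
    show "9 \<le> p" "9 \<le> q" "balanced p q" using pp qq p' bal by auto
    show "eigvec (p + q + 2) (U_edge p q) \<mu> ?y" "\<exists>i<p + q + 2. ?y i \<noteq> 0" unfolding npq by (rule evy nzy)+
  qed (use sP sN in auto)
  then have "\<forall>i<n. \<forall>j<n. E (\<sigma> i) (\<sigma> j) \<longleftrightarrow> U_edge p q i j" using iso Qy Q by simp
  then show ?thesis using bij pp qq by blast
qed

lemma eigvec_uminus: "eigvec n E \<mu> x \<Longrightarrow> eigvec n E \<mu> (\<lambda>i. - x i)"
proof -
  assume ev: "eigvec n E \<mu> x"
  have "nbr_sum n E (\<lambda>i. - x i) i = - nbr_sum n E x i" for i
    unfolding nbr_sum_def sum_negf[symmetric] by (intro sum.cong) auto
  then show ?thesis using ev by (simp add: eigvec_def vsum_def sum_negf)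
qed

lemma graph_iso_if_colambda_ge:
  assumes U: "unicyclic n E" and bal: "balanced p q" "q \<ge> 9" and n: "p + q + 2 = n"
    and ge: "colambda n (U_edge p q) \<le> colambda n E"
  shows "graph_iso n E n (U_edge p q)"
proof -
  have G: "simple_graph n E" using U by (simp add: unicyclic_def)
  have n0: "n > 0" using n by simp
  obtain x where x: "eigvec n E (colambda n E) x" "\<exists>i<n. x i \<noteq> 0" using colambda_eigvec[OF n0 G] by blast
  \<comment> \<open>Zero entries go to \<open>P\<close>. The comparison asks for weak signs on both
    parts, so the same split serves \<open>-x\<close> with \<open>P\<close> and \<open>N\<close>
    exchanged.\<close>
  define P where "P = {i. i < n \<and> 0 \<le> x i}"
  define N where "N = {i. i < n \<and> x i < 0}"
  have PN: "P \<union> N = {..<n}" "P \<inter> N = {}" "N \<union> P = {..<n}" "N \<inter> P = {}"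
    by (auto simp: P_def N_def)
  have "card P + card N = n"
    using PN(1,2) by (metis card_Un_disjoint card_lessThan finite_Un finite_lessThan)
  \<comment> \<open>There are at least 20 vertices, so a cycle meeting both parts can be treated
    from the side of a part with four or more.\<close>
  then have card: "card N \<ge> 4 \<or> card P \<ge> 4" using n bal by (auto simp: balanced_def)
  obtain vs where vs: "3 \<le> length vs" "distinct vs" "set vs \<subseteq> {0..<n}"
    "\<And>i. i < length vs \<Longrightarrow> E (vs ! i) (vs ! ((i + 1) mod length vs))"
    "\<And>i k l. i < length vs \<Longrightarrow> k = vs ! i \<Longrightarrow> l = vs ! ((i + 1) mod length vs) \<Longrightarrow>
       connected_graph n (del_edge E k l) \<and> (\<forall>C. \<not> cycle_edge_set n (del_edge E k l) C)"
    using unicyclic_decomp[OF U] by (metis (no_types, lifting))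
  have A: "\<exists>\<sigma>. bij_betw \<sigma> {..<n} {..<n} \<and> (\<forall>i<n. \<forall>j<n. E (\<sigma> i) (\<sigma> j) \<longleftrightarrow> U_edge p q i j)"
    if "set vs \<subseteq> N \<or> \<not> set vs \<subseteq> P \<and> \<not> set vs \<subseteq> N \<and> card N \<ge> 4"
    by (rule relabelling_if_colambda_ge[OF U bal n x ge PN(1,2) _ _ vs that]) (auto simp: P_def N_def)
  have x': "\<exists>i<n. - x i \<noteq> 0" using x(2) by simp
  have B: "\<exists>\<sigma>. bij_betw \<sigma> {..<n} {..<n} \<and> (\<forall>i<n. \<forall>j<n. E (\<sigma> i) (\<sigma> j) \<longleftrightarrow> U_edge p q i j)"
    if "set vs \<subseteq> P \<or> \<not> set vs \<subseteq> N \<and> \<not> set vs \<subseteq> P \<and> card P \<ge> 4"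
    by (rule relabelling_if_colambda_ge[OF U bal n eigvec_uminus[OF x(1)] x' ge PN(3,4) _ _ vs that])
      (auto simp: P_def N_def)
  obtain \<sigma> where bij: "bij_betw \<sigma> {..<n} {..<n}"
    and iso: "\<forall>i<n. \<forall>j<n. E (\<sigma> i) (\<sigma> j) \<longleftrightarrow> U_edge p q i j"
    using A B card by blast
  \<comment> \<open>\<open>\<sigma>\<close> leads from the labels of \<open>U(p,q)\<close> to those
    of \<open>E\<close>, while \<open>graph_iso\<close> asks for the opposite direction.\<close>
  let ?f = "inv_into {..<n} \<sigma>"
  have "bij_betw ?f {..<n} {..<n}" by (rule bij_betw_inv_into[OF bij])
  moreover have "E i j \<longleftrightarrow> U_edge p q (?f i) (?f j)" if "i < n" "j < n" for i j
  proof -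
    have "\<sigma> (?f i) = i" "\<sigma> (?f j) = j" using bij_betw_inv_into_right[OF bij] that by auto
    moreover have "?f i < n" "?f j < n" using \<open>bij_betw ?f _ _\<close> that by (auto simp: bij_betw_def)
    ultimately show ?thesis using iso by metis
  qed
  ultimately show ?thesis unfolding graph_iso_def lessThan_atLeast0 by blast
qed

section \<open>Invariance under isomorphism and the final comparison\<close>

lemma graph_iso_sym:
  assumes "graph_iso n E n F"
  shows "graph_iso n F n E"
proof -
  obtain f where f: "bij_betw f {0..<n} {0..<n}" "\<forall>i<n. \<forall>j<n. E i j \<longleftrightarrow> F (f i) (f j)"
    using assms by (auto simp: graph_iso_def)
  let ?g = "inv_into {0..<n} f"
  have g: "bij_betw ?g {0..<n} {0..<n}" by (rule bij_betw_inv_into[OF f(1)])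
  have "F i j \<longleftrightarrow> E (?g i) (?g j)" if "i < n" "j < n" for i j
  proof -
    have "f (?g i) = i" "f (?g j) = j" using bij_betw_inv_into_right[OF f(1)] that by auto
    moreover have "?g i < n" "?g j < n" using g that by (auto simp: bij_betw_def)
    ultimately show ?thesis using f(2) by metis
  qed
  then show ?thesis using g unfolding graph_iso_def by blast
qed

text \<open>An eigenvector of \<open>F\<close> pulls back along the isomorphism; the inverse
  isomorphism supplies the other inequality.\<close>

lemma colambda_le_if_iso:
  assumes G: "simple_graph n E" "simple_graph n F" and n: "n > 0" and iso: "graph_iso n E n F"
  shows "colambda n F \<le> colambda n E"
proof -
  obtain f where f: "bij_betw f {..<n} {..<n}" "\<forall>i<n. \<forall>j<n. E i j \<longleftrightarrow> F (f i) (f j)"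
    using iso unfolding graph_iso_def lessThan_atLeast0 by blast
  obtain y where y: "eigvec n F (colambda n F) y" "\<exists>i<n. y i \<noteq> 0" using colambda_eigvec[OF n G(2)] by blast
  have fn: "f i < n" if "i < n" for i using f(1) that by (auto simp: bij_betw_def)
  have "nbr_sum n E (\<lambda>i. y (f i)) i = nbr_sum n F y (f i)" if "i < n" for i
  proof -
    have "nbr_sum n E (\<lambda>i. y (f i)) i = (\<Sum>j<n. if F (f i) (f j) then y (f j) else 0)"
      unfolding nbr_sum_def using f(2) that by (intro sum.cong) auto
    also have "\<dots> = nbr_sum n F y (f i)" unfolding nbr_sum_def by (rule sum.reindex_bij_betw[OF f(1)])
    finally show ?thesis .
  qed
  moreover have "vsum n (\<lambda>i. y (f i)) = vsum n y" unfolding vsum_def by (rule sum.reindex_bij_betw[OF f(1)])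
  ultimately have ev: "eigvec n E (colambda n F) (\<lambda>i. y (f i))" using y(1) fn by (simp add: eigvec_def)
  obtain i where i: "i < n" "y i \<noteq> 0" using y(2) by blast
  then have "i \<in> f ` {..<n}" using f(1) by (simp add: bij_betw_def)
  then obtain j where "j < n" "f j = i" by blast
  then show ?thesis using colambda_ge[OF G(1) ev, of j] i by simp
qed

theorem theorem3p4:
  fixes n :: nat and E :: "nat \<Rightarrow> nat \<Rightarrow> bool"
  assumes "n \<ge> 20" and "unicyclic n E"
  defines "p \<equiv> nat \<lceil>(real n - 2) / 2\<rceil>" and "q \<equiv> nat \<lfloor>(real n - 2) / 2\<rfloor>"
  shows "lambda_min n (complement n E) \<ge> lambda_min (p + q + 2) (complement (p + q + 2) (U_edge p q))
     \<and> (lambda_min n (complement n E) = lambda_min (p + q + 2) (complement (p + q + 2) (U_edge p q))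
        \<longleftrightarrow> graph_iso n E (p + q + 2) (U_edge p q))"
proof -
  \<comment> \<open>\<open>n = 2 * k\<close> gives \<open>p = q = k - 1\<close>, and
    \<open>n = 2 * k + 1\<close> gives \<open>p = k\<close>, \<open>q = k - 1\<close>; in both cases
    \<open>k \<ge> 10\<close>.\<close>
  have pq: "balanced p q \<and> q \<ge> 9 \<and> p + q + 2 = n"
  proof (cases "even n")
    case True
    then obtain k where k: "n = 2 * k" by blast
    then have e: "(real n - 2) / 2 = of_int (int k - 1)" by simp
    show ?thesis unfolding p_def q_def balanced_def e ceiling_of_int floor_of_int using k assms(1) by auto
  next
    case False
    then obtain k where k: "n = 2 * k + 1" by (elim oddE)
    then have e: "(real n - 2) / 2 = real k - 1 / 2" by (simp add: field_simps)
    have "\<lceil>real k - 1 / 2\<rceil> = int k" "\<lfloor>real k - 1 / 2\<rfloor> = int k - 1" by linarith+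
    then show ?thesis unfolding p_def q_def balanced_def e using k assms(1) by auto
  qed
  then have bal: "balanced p q" "q \<ge> 9" and n: "p + q + 2 = n" by auto
  have GE: "simple_graph n E" using assms(2) by (simp add: unicyclic_def)
  have GU: "simple_graph n (U_edge p q)"
    using simple_graph_U_edge[of p q] bal n by (auto simp: balanced_def)
  have n0: "n > 0" using assms(1) by simp
  have ge: "graph_iso n E n (U_edge p q)" if "colambda n (U_edge p q) \<le> colambda n E"
    by (rule graph_iso_if_colambda_ge[OF assms(2) bal n that])
  have eq: "colambda n E = colambda n (U_edge p q)" if "graph_iso n E n (U_edge p q)"
    using colambda_le_if_iso[OF GE GU n0 that] colambda_le_if_iso[OF GU GE n0 graph_iso_sym[OF that]] by simp
  \<comment> \<open>If this failed, \<open>ge\<close> would give an isomorphism and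
    \<open>eq\<close> then equality.\<close>
  have "colambda n E \<le> colambda n (U_edge p q)" using ge eq by linarith
  moreover have "colambda n E = colambda n (U_edge p q) \<longleftrightarrow> graph_iso n E n (U_edge p q)"
    using ge eq by auto
  ultimately show ?thesis unfolding n colambda_def by auto
qed

end
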